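(* Let $\Omega\subseteq\mathbb{P}(\mathbb{R}^d)$ be a quasi-homogeneous properly convex domain and $1\le m\le d-1$. Then the following are equivalent: (1) $\mathrm{r}_{\rm PES}(\Omega)\le m$; (2) there exists a positive constant $\delta=\delta(\Omega)$ such that every compact $k$-simplex in $\Omega$ with $k\ge m+1$ is $\delta$-slim; (3) if $E\subset\partial\Omega$ is any open face of $\Omega$, then $\mathrm{r}_{\rm PES}(E)\le m-1$.
   Context: A properly convex domain is a nonempty open set $\Omega\subset\mathbb{P}(\mathbb{R}^d)$ whose closure $\overline{\Omega}$ lies in some affine chart, in which $\Omega$ is a bounded convex set; $\Omega$ itself is assumed to have dimension at least one. $\partial\Omega=\overline\Omega\setminus\Omega$, $\mathrm{Aut}(\Omega)=\{g\in \mathrm{PGL}_d(\mathbb{R}): g\Omega=\Omega\}$, and $\Omega$ is quasi-homogeneous if there is a compact $K\subset\Omega$ with $\mathrm{Aut}(\Omega)\cdot K=\Omega$. Hilbert metric: for distinct $x,y\in\Omega$ let $x_\infty,y_\infty\in\partial\Omega$ be the endpoints of the intersection of the projective line through $x,y$ with $\overline\Omega$, ordered $x_\infty,x,y,y_\infty$; then $d_\Omega(x,y)=\frac12\log\frac{|y-x_\infty||x-y_\infty|}{|x-x_\infty||y-y_\infty|}$ (and $d_\Omega(x,x)=0$). For nonempty $C\subset\Omega$ and $\delta>0$, $\mathcal{N}_\delta(C)=\{x\in\Omega: d_\Omega(x,C)<\delta\}$. $\mathrm{CH}_\Omega(X)$ is the convex hull of $X$ in $\overline\Omega$, i.e. the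 intersection of all convex subsets of $\overline\Omega$ (convex in the affine chart) containing $X$. For $k\ge1$, a $k$-simplex is $S=\mathrm{CH}_\Omega(v_0,\dots,v_k)$ with an ordered tuple of vertices $v_0,\dots,v_k\in\overline\Omega$ (no general position is required); it is non-degenerate if $\dim\mathbb{P}(\mathrm{Span}\{v_0,\dots,v_k\})=k$. Its facets are $F^i(S)=\mathrm{CH}_\Omega(v_0,\dots,\widehat{v_i},\dots,v_k)$. It is a compact $k$-simplex in $\Omega$ if all $v_i\in\Omega$. A compact $k$-simplex $S$ is $\delta$-slim if for all $0\le i\le k$, $F^i(S)\subset\bigcup_{j\ne i}\mathcal{N}_\delta(F^j(S))$. A $k$-dimensional PES in $\Omega$, $k\ge1$, is a non-degenerate $k$-simplex $S$ with vertices in $\partial\Omega$ such that $S\cap\Omega\ne\emptyset$ and $F^i(S)\subset\partial\Omega$ for all $i$. The projective simplex rank is $\mathrm{r}_{\rm PES}(\Omega)=\sup\{\dim S: S\text{ is a PES in }\Omega\}$. An open face of $\Omega$ in $\partial\Omega$ is a set $E=F_\Omega(x)$ with $x\in\partial\Omega$, where $F_\Omega(x)=\{x\}\cup\{y\in\overline\Omega: x\text{ and }y\text{ lie in a common open projective segment contained in }\overline\Omega\}$. Such an $E$ is a properly convex domain in $\mathbb{P}(\mathrm{Span}\,E)$, so $\mathrm{r}_{\rm PES}(E)$ is defined there; if $E$ is a single point, $\mathrm{r}_{\rm PES}(E)=0$. *)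

theory Defs
  imports "HOL-Analysis.Analysis" "HOL-Library.Extended_Nat"
begin

section \<open>Real projective space\<close>

text \<open>The points of \<open>P(R^d)\<close>, with \<open>d = CARD('d)\<close>, are the lines through the origin
  in \<^typ>\<open>real^'d\<close>.\<close>

typedef (overloaded) ('d::finite) proj =
    "{L :: (real^'d) set. \<exists>v. v \<noteq> 0 \<and> L = span {v}}"
  morphisms line_of Abs_proj
proof -
  have "span {axis undefined 1 :: real^'d} \<in> {L. \<exists>v. v \<noteq> 0 \<and> L = span {v}}"
    by (auto simp: axis_eq_0_iff intro!: exI[of _ "axis undefined 1"])
  then show ?thesis by blast
qed

definition proj_pt :: "real^'d::finite \<Rightarrow> 'd proj" where
  "proj_pt v = Abs_proj (span {v})"

lemma line_of_proj_pt: "v \<noteq> 0 \<Longrightarrow> line_of (proj_pt v) = span {v}"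
  unfolding proj_pt_def by (rule Abs_proj_inverse) auto

text \<open>The quotient topology with respect to \<^const>\<open>proj_pt\<close> on the nonzero vectors, which form
  an open subset of \<^typ>\<open>real^'d\<close>.\<close>

instantiation proj :: (finite) topological_space
begin

definition open_proj :: "'a proj set \<Rightarrow> bool" where
  "open_proj U \<longleftrightarrow> open {v. v \<noteq> 0 \<and> proj_pt v \<in> U}"

instance
proof
  have "{v :: real^'a. v \<noteq> 0 \<and> proj_pt v \<in> UNIV} = - {0}" by auto
  then show "open (UNIV :: 'a proj set)"
    unfolding open_proj_def by (simp add: open_Compl)
next
  fix S T :: "'a proj set"
  assume "open S" "open T"
  then have "open ({v. v \<noteq> 0 \<and> proj_pt v \<in> S} \<inter> {v. v \<noteq> 0 \<and> proj_pt v \<in> T})"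
    unfolding open_proj_def by (rule open_Int)
  moreover have "{v. v \<noteq> 0 \<and> proj_pt v \<in> S} \<inter> {v. v \<noteq> 0 \<and> proj_pt v \<in> T}
      = {v. v \<noteq> 0 \<and> proj_pt v \<in> S \<inter> T}" by auto
  ultimately show "open (S \<inter> T)" unfolding open_proj_def by simp
next
  fix K :: "'a proj set set"
  assume "\<forall>S\<in>K. open S"
  then have "open (\<Union>S\<in>K. {v. v \<noteq> 0 \<and> proj_pt v \<in> S})"
    unfolding open_proj_def by blast
  moreover have "(\<Union>S\<in>K. {v. v \<noteq> 0 \<and> proj_pt v \<in> S}) = {v. v \<noteq> 0 \<and> proj_pt v \<in> \<Union>K}"
    by auto
  ultimately show "open (\<Union>K)" unfolding open_proj_def by simp
qed

end

definition lin_span :: "'d::finite proj set \<Rightarrow> (real^'d) set" where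
  "lin_span X = span (\<Union>p\<in>X. line_of p)"

definition proj_line :: "'d::finite proj \<Rightarrow> 'd proj \<Rightarrow> 'd proj set" where
  "proj_line x y = {z. line_of z \<subseteq> lin_span {x, y}}"

text \<open>\<open>PGL\<close> acts faithfully on projective space and is identified with the group of
  transformations it induces.\<close>

definition proj_map :: "real^'d^'d::finite \<Rightarrow> 'd proj \<Rightarrow> 'd proj" where
  "proj_map A p = Abs_proj ((*v) A ` line_of p)"

definition PGL :: "('d::finite proj \<Rightarrow> 'd proj) set" where
  "PGL = {proj_map A |A. invertible A}"

text \<open>A nonzero \<open>f\<close> determines the affine chart consisting of the points off the hyperplane
  orthogonal to \<open>f\<close>; such a point is identified with its representative in the affine
  hyperplane \<open>{v. f \<bullet> v = 1}\<close>.\<close>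

definition chart_dom :: "real^'d::finite \<Rightarrow> 'd proj set" where
  "chart_dom f = {p. \<exists>v\<in>line_of p. f \<bullet> v \<noteq> 0}"

definition chart :: "real^'d::finite \<Rightarrow> 'd proj \<Rightarrow> real^'d" where
  "chart f p = (THE v. v \<in> line_of p \<and> f \<bullet> v = 1)"

definition open_proj_segment :: "'d::finite proj set \<Rightarrow> bool" where
  "open_proj_segment s \<longleftrightarrow> (\<exists>a b. a \<noteq> 0 \<and> b \<noteq> 0 \<and> proj_pt a \<noteq> proj_pt b \<and>
     s = {proj_pt (\<alpha> *\<^sub>R a + \<beta> *\<^sub>R b) |\<alpha> \<beta>. \<alpha> > 0 \<and> \<beta> > 0})"


section \<open>Properly convex domains\<close>

definition convex_chart :: "'d::finite proj set \<Rightarrow> real^'d \<Rightarrow> bool" where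
  "convex_chart \<Omega> f \<longleftrightarrow> f \<noteq> 0 \<and> closure \<Omega> \<subseteq> chart_dom f \<and>
     bounded (chart f ` \<Omega>) \<and> convex (chart f ` \<Omega>)"

text \<open>The last conjunct says that \<open>\<Omega>\<close> has dimension at least one.\<close>

definition properly_convex_domain :: "'d::finite proj set \<Rightarrow> bool" where
  "properly_convex_domain \<Omega> \<longleftrightarrow>
     \<Omega> \<noteq> {} \<and> open \<Omega> \<and> (\<exists>f. convex_chart \<Omega> f) \<and> CARD('d) \<ge> 2"

text \<open>Not \<^const>\<open>frontier\<close>: the notions below are also applied to a face \<open>E\<close>, which is
  open only in \<open>P(Span E)\<close>. As \<open>P(Span E)\<close> is closed, the closure of \<open>E\<close> there is its
  closure in the whole projective space.\<close>

definition pboundary :: "'d::finite proj set \<Rightarrow> 'd proj set" where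
  "pboundary \<Omega> = closure \<Omega> - \<Omega>"

definition Aut :: "'d::finite proj set \<Rightarrow> ('d proj \<Rightarrow> 'd proj) set" where
  "Aut \<Omega> = {g \<in> PGL. g ` \<Omega> = \<Omega>}"

definition quasi_homogeneous :: "'d::finite proj set \<Rightarrow> bool" where
  "quasi_homogeneous \<Omega> \<longleftrightarrow> (\<exists>K. compact K \<and> K \<subseteq> \<Omega> \<and> (\<Union>g\<in>Aut \<Omega>. g ` K) = \<Omega>)"

text \<open>An arbitrary but fixed affine chart for \<open>\<Omega>\<close>. Neither convexity of subsets of the
  closure nor the cross-ratio below depends on which one is chosen. For a face \<open>E\<close> it is a chart
  of the whole space; its restrictions to \<open>P(Span E)\<close> are the charts there, since linear
  functionals extend.\<close>

definition chart_of :: "'d::finite proj set \<Rightarrow> real^'d" where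
  "chart_of \<Omega> = (SOME f. convex_chart \<Omega> f)"

definition CH :: "'d::finite proj set \<Rightarrow> 'd proj set \<Rightarrow> 'd proj set" where
  "CH \<Omega> X = \<Inter>{C. C \<subseteq> closure \<Omega> \<and> convex (chart (chart_of \<Omega>) ` C) \<and> X \<subseteq> C}"

text \<open>\<open>a\<close> and \<open>b\<close> are the endpoints \<open>x\<^sub>\<infinity>\<close> and \<open>y\<^sub>\<infinity>\<close>, in the order
  \<open>a, x, y, b\<close>.\<close>

definition chord_ends ::
    "'d::finite proj set \<Rightarrow> 'd proj \<Rightarrow> 'd proj \<Rightarrow> 'd proj \<Rightarrow> 'd proj \<Rightarrow> bool" where
  "chord_ends \<Omega> x y a b \<longleftrightarrow> (let \<phi> = chart (chart_of \<Omega>) in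
     a \<in> pboundary \<Omega> \<and> b \<in> pboundary \<Omega> \<and>
     \<phi> ` (proj_line x y \<inter> closure \<Omega>) = closed_segment (\<phi> a) (\<phi> b) \<and>
     \<phi> x \<in> open_segment (\<phi> a) (\<phi> y) \<and> \<phi> y \<in> open_segment (\<phi> x) (\<phi> b))"

definition hilbert_dist :: "'d::finite proj set \<Rightarrow> 'd proj \<Rightarrow> 'd proj \<Rightarrow> real" where
  "hilbert_dist \<Omega> x y = (if x = y then 0 else
     (THE r. \<exists>a b. chord_ends \<Omega> x y a b \<and>
        (let \<phi> = chart (chart_of \<Omega>) in
         r = 1/2 * ln ((norm (\<phi> y - \<phi> a) * norm (\<phi> x - \<phi> b)) /
                       (norm (\<phi> x - \<phi> a) * norm (\<phi> y - \<phi> b))))))"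

definition nbhd :: "'d::finite proj set \<Rightarrow> real \<Rightarrow> 'd proj set \<Rightarrow> 'd proj set" where
  "nbhd \<Omega> \<delta> C = {x \<in> \<Omega>. (INF y\<in>C. hilbert_dist \<Omega> x y) < \<delta>}"


section \<open>Simplices\<close>

text \<open>The vertex tuple of a \<open>k\<close>-simplex is given by the values \<open>v 0, \<dots>, v k\<close> of a
  sequence \<open>v\<close>; its other values are irrelevant.\<close>

definition proj_simplex :: "'d::finite proj set \<Rightarrow> nat \<Rightarrow> (nat \<Rightarrow> 'd proj) \<Rightarrow> 'd proj set" where
  "proj_simplex \<Omega> k v = CH \<Omega> (v ` {..k})"

definition facet ::
    "'d::finite proj set \<Rightarrow> nat \<Rightarrow> (nat \<Rightarrow> 'd proj) \<Rightarrow> nat \<Rightarrow> 'd proj set" where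
  "facet \<Omega> k v i = CH \<Omega> (v ` ({..k} - {i}))"

text \<open>The projectivization of a linear space of dimension \<open>k + 1\<close> has dimension \<open>k\<close>.\<close>

definition nondegenerate :: "nat \<Rightarrow> (nat \<Rightarrow> 'd::finite proj) \<Rightarrow> bool" where
  "nondegenerate k v \<longleftrightarrow> dim (lin_span (v ` {..k})) = k + 1"

definition compact_simplex :: "'d::finite proj set \<Rightarrow> nat \<Rightarrow> (nat \<Rightarrow> 'd proj) \<Rightarrow> bool" where
  "compact_simplex \<Omega> k v \<longleftrightarrow> k \<ge> 1 \<and> (\<forall>i\<le>k. v i \<in> \<Omega>)"

definition slim :: "'d::finite proj set \<Rightarrow> real \<Rightarrow> nat \<Rightarrow> (nat \<Rightarrow> 'd proj) \<Rightarrow> bool" where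
  "slim \<Omega> \<delta> k v \<longleftrightarrow>
     (\<forall>i\<le>k. facet \<Omega> k v i \<subseteq> (\<Union>j\<in>{..k} - {i}. nbhd \<Omega> \<delta> (facet \<Omega> k v j)))"

definition PES :: "'d::finite proj set \<Rightarrow> nat \<Rightarrow> (nat \<Rightarrow> 'd proj) \<Rightarrow> bool" where
  "PES \<Omega> k v \<longleftrightarrow> k \<ge> 1 \<and> nondegenerate k v \<and> (\<forall>i\<le>k. v i \<in> pboundary \<Omega>) \<and>
     proj_simplex \<Omega> k v \<inter> \<Omega> \<noteq> {} \<and> (\<forall>i\<le>k. facet \<Omega> k v i \<subseteq> pboundary \<Omega>)"

text \<open>A one-point set has empty \<^const>\<open>pboundary\<close>, hence no PES, and the empty supremum
  is \<open>0\<close>.\<close>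

definition r_PES :: "'d::finite proj set \<Rightarrow> enat" where
  "r_PES \<Omega> = (SUP k\<in>{k. \<exists>v. PES \<Omega> k v}. enat k)"

definition face_at :: "'d::finite proj set \<Rightarrow> 'd proj \<Rightarrow> 'd proj set" where
  "face_at \<Omega> x = {x} \<union> {y \<in> closure \<Omega>.
     \<exists>s. open_proj_segment s \<and> s \<subseteq> closure \<Omega> \<and> x \<in> s \<and> y \<in> s}"

definition open_face :: "'d::finite proj set \<Rightarrow> 'd proj set \<Rightarrow> bool" where
  "open_face \<Omega> E \<longleftrightarrow> (\<exists>x\<in>pboundary \<Omega>. E = face_at \<Omega> x)"

end

theory Submission
  imports Defs
begin

text \<open>Everything happens in the open convex cone \<open>I\<close> over \<open>\<Omega>\<close> in \<open>R^d\<close> and its closure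
  \<open>K\<close>. Vectors \<open>u 0, \<dots>, u k\<close> in \<open>K\<close> span a PES, after rescaling, if and only if their sum
  lies in \<open>I\<close> but no sum with one of them left out does; linear independence is then
  automatic. The Hilbert distance of \<open>u\<close> and \<open>w\<close> is \<open>- ln (a * b) / 2\<close> for the largest \<open>a\<close> and
  \<open>b\<close> with \<open>u - a w\<close> and \<open>w - b u\<close> in \<open>K\<close>.

  PES are produced by a single limit argument: let \<open>z n = w n 0 + \<dots> + w n k\<close> be points of \<open>I\<close>
  such that, for each \<open>\<epsilon> > 0\<close> and large \<open>n\<close>, no \<open>z n - w n j - \<epsilon> z n\<close> lies in \<open>I\<close>.
  Quasi-homogeneity moves the \<open>z n\<close> into a compact set, and the images of the \<open>w n i\<close> subconverge to
  the vertices of a PES.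

  For (1) \<open>\<Longrightarrow>\<close> (3) take \<open>z n = y + p / (n + 1)\<close> with \<open>y\<close> in the face and \<open>p\<close> in \<open>I\<close>; conversely,
  the face through the interior of a facet of a PES contains that facet as a PES. For
  (1) \<open>\<Longrightarrow>\<close> (2), let \<open>x\<close> be a point of the facet opposite the vertex \<open>v\<close> at distance at least \<open>n\<close>
  from the other facets, let \<open>\<mu>\<close> be maximal with \<open>x - \<mu> v\<close> in \<open>K\<close>, and take \<open>z n = v + t x\<close> with
  \<open>t \<mu> = exp (- n)\<close>: this point is far from all facets at once. Conversely, if \<open>x\<close> is the sum of
  the vectors \<open>u i\<close> of a PES, then a simplex with vertices close to \<open>u 0\<close> and \<open>u 0 / k + u i\<close>,
  \<open>i \<ge> 1\<close>, has \<open>x\<close> on one facet and its other facets close to the boundary.\<close>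

section \<open>Convex hulls in charts via cones\<close>

lemma proj_pt_scale:
  assumes "c \<noteq> 0"
  shows "proj_pt (c *\<^sub>R v) = proj_pt v"
proof -
  have "span {c *\<^sub>R v} = span {v}"
  proof -
    have "x *\<^sub>R v \<in> range (\<lambda>k. k *\<^sub>R (c *\<^sub>R v))" for x
      using assms by (intro range_eqI[of _ _ "x / c"]) simp
    then show ?thesis unfolding span_singleton by auto
  qed
  then show ?thesis by (simp add: proj_pt_def)
qed

lemma proj_pt_minus [simp]: "proj_pt (- v) = proj_pt v"
  using proj_pt_scale[of "-1" v] by simp

lemma proj_pt_eqD:
  assumes "u \<noteq> 0" "v \<noteq> 0" "proj_pt u = proj_pt v"
  obtains c where "c \<noteq> 0" "u = c *\<^sub>R v"
proof -
  have "u \<in> span {v}"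
    using assms line_of_proj_pt span_base by (metis singletonI)
  then obtain c where "u = c *\<^sub>R v" by (auto simp: span_singleton)
  with assms that show thesis by auto
qed

lemma proj_cases:
  obtains v where "v \<noteq> 0" "p = proj_pt v"
proof -
  have "line_of p \<in> {L. \<exists>v. v \<noteq> 0 \<and> L = span {v}}" by (rule line_of)
  then obtain v where "v \<noteq> 0" "line_of p = span {v}" by blast
  moreover from this have "p = proj_pt v"
    unfolding proj_pt_def by (metis line_of_inverse)
  ultimately show thesis using that by blast
qed

lemma proj_cases_pos:
  assumes "p \<in> chart_dom f"
  obtains v where "f \<bullet> v > 0" "p = proj_pt v"
proof -
  obtain v where v: "v \<noteq> 0" "p = proj_pt v" by (rule proj_cases)
  with assms have "f \<bullet> v \<noteq> 0"
    by (auto simp: chart_dom_def line_of_proj_pt span_singleton)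
  with that[of v] that[of "- v"] v show thesis by fastforce
qed

lemma proj_pt_in_chart_dom: "v \<noteq> 0 \<Longrightarrow> proj_pt v \<in> chart_dom f \<longleftrightarrow> f \<bullet> v \<noteq> 0"
  by (auto simp: chart_dom_def line_of_proj_pt span_singleton)

lemma chart_proj_pt:
  assumes "f \<bullet> v \<noteq> 0"
  shows "chart f (proj_pt v) = (1 / (f \<bullet> v)) *\<^sub>R v"
proof -
  have "v \<noteq> 0" using assms by auto
  then show ?thesis
    using assms unfolding chart_def
    by (intro the_equality) (auto simp: line_of_proj_pt span_singleton field_simps)
qed

lemma proj_map_proj_pt: "proj_map A (proj_pt v) = proj_pt (A *v v)" if "v \<noteq> 0"
proof -
  have "(*v) A ` span {v} = span ((*v) A ` {v})"
    by (metis matrix_vector_mul_linear linear_span_image)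
  then show ?thesis using that by (simp add: proj_map_def proj_pt_def line_of_proj_pt[unfolded proj_pt_def])
qed

text \<open>The quotient topology pulls an open neighbourhood of \<open>proj_pt v\<close> back to an
  open neighbourhood of \<open>v\<close>, so closures can be tested on representatives.\<close>

lemma proj_pt_mem_closureI:
  assumes "v \<noteq> 0" "v \<in> closure S" "\<And>x. x \<in> S \<Longrightarrow> proj_pt x \<in> W"
  shows "proj_pt v \<in> closure W"
proof -
  have "W \<inter> T \<noteq> {}" if "open T" "proj_pt v \<in> T" for T
  proof -
    have "open {v. v \<noteq> 0 \<and> proj_pt v \<in> T}" using that(1) by (simp add: open_proj_def)
    moreover have "v \<in> {v. v \<noteq> 0 \<and> proj_pt v \<in> T}" using that assms by auto
    ultimately have "S \<inter> {v. v \<noteq> 0 \<and> proj_pt v \<in> T} \<noteq> {}"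
      using assms(2) closure_iff_nhds_not_empty by blast
    then show ?thesis using assms(3) by blast
  qed
  then show ?thesis
    by (meson closure_iff_nhds_not_empty disjoint_iff subsetD)
qed

section \<open>The cone over a set of points, on the positive side of a functional\<close>

definition lift :: "real^'d::finite \<Rightarrow> 'd proj set \<Rightarrow> (real^'d) set" where
  "lift f W = {v. f \<bullet> v > 0 \<and> proj_pt v \<in> W}"

lemma mem_lift: "v \<in> lift f W \<longleftrightarrow> f \<bullet> v > 0 \<and> proj_pt v \<in> W"
  by (simp add: lift_def)

lemma lift_scale: "v \<in> lift f W \<Longrightarrow> 0 < c \<Longrightarrow> c *\<^sub>R v \<in> lift f W"
  by (simp add: lift_def proj_pt_scale)

text \<open>In the chart, the class of \<open>x + y\<close> is the average of the classes of
  \<open>x\<close> and \<open>y\<close> with weights proportional to \<open>f \<bullet> x\<close>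
  and \<open>f \<bullet> y\<close>. Convexity of the chart image thus becomes closure of the cone
  under addition.\<close>

lemma lift_add:
  assumes "convex_chart W f" "x \<in> lift f W" "y \<in> lift f W"
  shows "x + y \<in> lift f W"
proof -
  have conv: "convex (chart f ` W)" and dom: "W \<subseteq> chart_dom f"
    using assms(1) closure_subset unfolding convex_chart_def by blast+
  have *: "(1 / (f \<bullet> v)) *\<^sub>R v \<in> chart f ` W" if "v \<in> lift f W" for v
    using that chart_proj_pt[of f v] unfolding lift_def by force
  define a where "a = f \<bullet> x"
  define b where "b = f \<bullet> y"
  have pos: "a > 0" "b > 0" using assms by (auto simp: lift_def a_def b_def)
  have "(a / (a + b)) *\<^sub>R ((1 / a) *\<^sub>R x) + (b / (a + b)) *\<^sub>R ((1 / b) *\<^sub>R y) \<in> chart f ` W"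
    using conv assms *[of x] *[of y] pos
    by (intro convexD) (auto simp: a_def b_def simp flip: add_divide_distrib)
  then have "(1 / (a + b)) *\<^sub>R (x + y) \<in> chart f ` W"
    using pos by (simp add: scaleR_add_right)
  then obtain p where p: "p \<in> W" "(1 / (a + b)) *\<^sub>R (x + y) = chart f p" by auto
  obtain v where v: "v \<noteq> 0" "p = proj_pt v" by (rule proj_cases)
  have nz: "x + y \<noteq> 0" using pos unfolding a_def b_def
    by (metis add_pos_pos inner_add_right inner_zero_right order_less_irrefl)
  have False: "f \<bullet> v \<noteq> 0" using p v dom proj_pt_in_chart_dom by blast
  then have "(1 / (a + b)) *\<^sub>R (x + y) = (1 / (f \<bullet> v)) *\<^sub>R v"
    using p v by (simp add: chart_proj_pt)
  then have "proj_pt (x + y) = proj_pt v"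
    using proj_pt_scale[of "1 / (a + b)" "x + y"] proj_pt_scale[of "1 / (f \<bullet> v)" v] pos False
    by simp
  then show ?thesis using p v pos by (simp add: lift_def a_def b_def inner_add_right)
qed

lemma proj_pt_chart:
  assumes "p \<in> chart_dom f"
  shows "proj_pt (chart f p) = p"
proof -
  obtain v where "f \<bullet> v > 0" "p = proj_pt v" using assms by (rule proj_cases_pos)
  then show ?thesis by (simp add: chart_proj_pt proj_pt_scale)
qed

lemma closure_scale_cone:
  fixes I :: "'a::real_normed_vector set"
  assumes "\<And>v c. v \<in> I \<Longrightarrow> 0 < c \<Longrightarrow> c *\<^sub>R v \<in> I" "v \<in> closure I" "0 < c"
  shows "c *\<^sub>R v \<in> closure I"
proof -
  have "(*\<^sub>R) c ` closure I = closure ((*\<^sub>R) c ` I)" by (rule closure_scaleR)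
  moreover have "closure ((*\<^sub>R) c ` I) \<subseteq> closure I"
    using assms by (intro closure_mono) auto
  ultimately show ?thesis using assms by blast
qed

text \<open>A nonzero limit of the cone is not in the kernel of \<open>f\<close>, because
  \<open>closure W\<close> stays inside the chart. For the converse, the part \<open>N\<close> of
  the open half-space outside the closed cone is open and stable under positive scaling, so its
  image is open in projective space; it misses \<open>W\<close>, hence also
  \<open>closure W\<close>.\<close>

lemma closure_lift_iff:
  assumes "convex_chart W f" "v \<noteq> 0"
  shows "v \<in> closure (lift f W) \<longleftrightarrow> f \<bullet> v > 0 \<and> proj_pt v \<in> closure W"
proof
  assume v: "v \<in> closure (lift f W)"
  have "proj_pt v \<in> closure W"
    using assms v by (intro proj_pt_mem_closureI) (auto simp: lift_def)
  moreover have "lift f W \<subseteq> {x. f \<bullet> x \<ge> 0}" by (auto simp: lift_def)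
  then have "closure (lift f W) \<subseteq> {x. f \<bullet> x \<ge> 0}"
    by (rule closure_minimal) (rule closed_halfspace_ge)
  ultimately show "f \<bullet> v > 0 \<and> proj_pt v \<in> closure W"
    using v assms proj_pt_in_chart_dom[of v f] unfolding convex_chart_def by force
next
  assume v: "f \<bullet> v > 0 \<and> proj_pt v \<in> closure W"
  show "v \<in> closure (lift f W)"
  proof (rule ccontr)
    assume nv: "v \<notin> closure (lift f W)"
    define N where "N = {w. f \<bullet> w > 0} - closure (lift f W)"
    have N: "c *\<^sub>R w \<in> N" if "w \<in> N" "0 < c" for c w
    proof -
      have "w \<in> closure (lift f W)" if "c *\<^sub>R w \<in> closure (lift f W)"
        using closure_scale_cone[OF lift_scale that, of "1 / c"] \<open>0 < c\<close> by simp
      then show ?thesis using that by (auto simp: N_def)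
    qed
    have "open N" unfolding N_def
      by (intro open_Diff closed_closure) (rule open_halfspace_gt)
    \<comment> \<open>A representative of a point of the image is a nonzero multiple of a vector of
      \<open>N\<close>; the sign of the factor decides between \<open>N\<close> and its
      negative.\<close>
    have eq: "{v. v \<noteq> 0 \<and> proj_pt v \<in> proj_pt ` N} = N \<union> uminus ` N"
    proof (intro set_eqI iffI)
      fix x assume "x \<in> {v. v \<noteq> 0 \<and> proj_pt v \<in> proj_pt ` N}"
      then obtain w where w: "x \<noteq> 0" "w \<in> N" "proj_pt x = proj_pt w" by auto
      then have "w \<noteq> 0" by (auto simp: N_def)
      then obtain c where c: "c \<noteq> 0" "x = c *\<^sub>R w" using w by (metis proj_pt_eqD)
      show "x \<in> N \<union> uminus ` N"
      proof (cases "c > 0")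
        case True
        then show ?thesis using N w c by auto
      next
        case False
        then have "(- c) *\<^sub>R w \<in> N" using N[of w "- c"] w c by auto
        then show ?thesis using c by (auto intro!: image_eqI[of _ _ "(- c) *\<^sub>R w"])
      qed
    next
      fix x assume "x \<in> N \<union> uminus ` N"
      then show "x \<in> {v. v \<noteq> 0 \<and> proj_pt v \<in> proj_pt ` N}"
        by (auto simp: N_def)
    qed
    have "open (proj_pt ` N)"
      unfolding open_proj_def eq using \<open>open N\<close> by (intro open_Un open_negations)
    moreover have "proj_pt v \<in> proj_pt ` N" using v nv by (auto simp: N_def)
    ultimately obtain y where y: "y \<in> W" "y \<in> proj_pt ` N"
      using v closure_iff_nhds_not_empty[of "proj_pt v" W] by blast
    then obtain w where "w \<in> N" "proj_pt w \<in> W" by auto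
    then have "w \<in> lift f W" "w \<notin> lift f W"
      using closure_subset[of "lift f W"] by (auto simp: N_def lift_def)
    then show False by simp
  qed
qed

section \<open>Pointed convex cones and their closures\<close>

lemma closure_of_ray:
  fixes z :: "'a::real_normed_vector"
  assumes "\<And>e. e > 0 \<Longrightarrow> z + e *\<^sub>R y \<in> S"
  shows "z \<in> closure S"
proof -
  have "(\<lambda>n. z + inverse (real (Suc n)) *\<^sub>R y) \<longlonglongrightarrow> z + 0 *\<^sub>R y"
    by (intro tendsto_intros LIMSEQ_inverse_real_of_nat)
  then show ?thesis
    using assms unfolding closure_sequential
    by (intro exI[of _ "\<lambda>n. z + inverse (real (Suc n)) *\<^sub>R y"]) auto
qed

text \<open>\<open>I\<close> may have empty interior, so that the locale covers the cones over faces
  as well as the cone over the domain.\<close>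

locale pos_cone =
  fixes I :: "'a::euclidean_space set" and f :: 'a
  assumes nonempty: "I \<noteq> {}"
    and add: "x \<in> I \<Longrightarrow> y \<in> I \<Longrightarrow> x + y \<in> I"
    and scale: "x \<in> I \<Longrightarrow> 0 < c \<Longrightarrow> c *\<^sub>R x \<in> I"
    and zero_notin: "0 \<notin> I"
    and closure_pos: "x \<in> closure I \<Longrightarrow> x \<noteq> 0 \<Longrightarrow> 0 < f \<bullet> x"
begin

abbreviation K where "K \<equiv> closure I"

lemma I_K: "x \<in> I \<Longrightarrow> x \<in> K" using closure_subset by auto

lemma pos: "x \<in> I \<Longrightarrow> 0 < f \<bullet> x"
  using closure_pos[of x] zero_notin I_K by auto

lemma K_nonneg: "x \<in> K \<Longrightarrow> 0 \<le> f \<bullet> x"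
  using closure_pos[of x] by (cases "x = 0") auto

lemma zero_K: "0 \<in> K"
proof -
  obtain x where x: "x \<in> I" using nonempty by auto
  then show ?thesis using scale by (intro closure_of_ray[of _ x]) simp
qed

lemma K_scale: "x \<in> K \<Longrightarrow> 0 \<le> c \<Longrightarrow> c *\<^sub>R x \<in> K"
  using closure_scale_cone[OF scale, of x c] zero_K by (cases "c = 0") auto

lemma K_add: assumes "x \<in> K" "y \<in> K" shows "x + y \<in> K"
proof -
  obtain a b where "\<And>n. a n \<in> I" "a \<longlonglongrightarrow> x" "\<And>n. b n \<in> I" "b \<longlonglongrightarrow> y"
    using assms unfolding closure_sequential by blast
  then show ?thesis unfolding closure_sequential
    by (intro exI[of _ "\<lambda>n. a n + b n"]) (auto intro: add tendsto_add)
qed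

lemma K_sum: "(\<And>i. i \<in> J \<Longrightarrow> x i \<in> K) \<Longrightarrow> sum x J \<in> K"
  by (induction J rule: infinite_finite_induct) (auto intro: zero_K K_add)

text \<open>\<open>f\<close> has a positive minimum on the compact set of unit vectors of
  \<open>K\<close>, and homogeneity extends the estimate to all of \<open>K\<close>. A bound on
  \<open>f\<close> therefore bounds the vectors themselves.\<close>

lemma norm_le: "\<exists>c>0. \<forall>x\<in>K. norm x \<le> c * (f \<bullet> x)"
proof (cases "K \<inter> sphere 0 1 = {}")
  case True
  have "x = 0" if "x \<in> K" for x
    using True K_scale[OF that, of "1 / norm x"] by (cases "x = 0") auto
  then have "norm x \<le> 1 * (f \<bullet> x)" if "x \<in> K" for x
    by (metis that inner_zero_right mult_zero_right norm_zero order_refl)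
  then show ?thesis by (intro exI[of _ 1]) simp
next
  case False
  have "compact (K \<inter> sphere 0 1)" by (simp add: closed_Int_compact)
  then obtain z where z: "z \<in> K \<inter> sphere 0 1" "\<And>x. x \<in> K \<inter> sphere 0 1 \<Longrightarrow> f \<bullet> z \<le> f \<bullet> x"
    using continuous_attains_inf[of "K \<inter> sphere 0 1" "\<lambda>x. f \<bullet> x"] False
      continuous_on_inner[OF continuous_on_const continuous_on_id] by blast
  have "f \<bullet> z > 0" using z(1) closure_pos[of z] by fastforce
  moreover have "norm x \<le> (1 / (f \<bullet> z)) * (f \<bullet> x)" if "x \<in> K" for x
  proof (cases "x = 0")
    case False
    then have "(1 / norm x) *\<^sub>R x \<in> K \<inter> sphere 0 1" using K_scale[OF that] by auto
    from z(2)[OF this] show ?thesis using False \<open>f \<bullet> z > 0\<close> by (simp add: field_simps)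
  qed auto
  ultimately show ?thesis by (intro exI[of _ "1 / (f \<bullet> z)"]) auto
qed

end

lemma pos_cone_lift:
  assumes "convex_chart W f" "W \<noteq> {}"
  shows "pos_cone (lift f W) f"
proof
  obtain p where "p \<in> W" using assms by auto
  moreover from this have "p \<in> chart_dom f"
    using assms closure_subset unfolding convex_chart_def by blast
  ultimately show "lift f W \<noteq> {}" by (auto elim!: proj_cases_pos simp: lift_def)
  show "0 \<notin> lift f W" by (simp add: lift_def)
qed (use assms lift_add lift_scale closure_lift_iff in blast)+

section \<open>Generated cones and convex hulls\<close>

definition conic :: "('i \<Rightarrow> 'a::real_vector) \<Rightarrow> 'i set \<Rightarrow> 'a set" where
  "conic u J = {\<Sum>i\<in>J. c i *\<^sub>R u i |c. \<forall>i\<in>J. 0 \<le> c i}"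

lemma conicI: "(\<And>i. i \<in> J \<Longrightarrow> 0 \<le> c i) \<Longrightarrow> (\<Sum>i\<in>J. c i *\<^sub>R u i) \<in> conic u J"
  unfolding conic_def by blast

lemma conicE:
  assumes "z \<in> conic u J"
  obtains c where "\<forall>i\<in>J. 0 \<le> c i" "z = (\<Sum>i\<in>J. c i *\<^sub>R u i)"
  using assms unfolding conic_def by blast

lemma conic_scale: assumes "z \<in> conic u J" "0 \<le> a" shows "a *\<^sub>R z \<in> conic u J"
proof -
  obtain c where "\<forall>i\<in>J. 0 \<le> c i" "z = (\<Sum>i\<in>J. c i *\<^sub>R u i)" using assms(1) by (rule conicE)
  then show ?thesis
    using conicI[of J "\<lambda>i. a * c i" u] assms(2) by (auto simp: scaleR_sum_right)
qed

lemma conic_add: assumes "y \<in> conic u J" "z \<in> conic u J" shows "y + z \<in> conic u J"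
proof -
  obtain b where "\<forall>i\<in>J. 0 \<le> b i" "y = (\<Sum>i\<in>J. b i *\<^sub>R u i)" using assms(1) by (rule conicE)
  moreover obtain c where "\<forall>i\<in>J. 0 \<le> c i" "z = (\<Sum>i\<in>J. c i *\<^sub>R u i)" using assms(2) by (rule conicE)
  ultimately show ?thesis
    using conicI[of J "\<lambda>i. b i + c i" u] by (auto simp: sum.distrib scaleR_left_distrib)
qed

lemma conic_generator: assumes "finite J" "i \<in> J" shows "u i \<in> conic u J"
proof -
  have "(\<Sum>j\<in>J. (if j = i then 1 else 0) *\<^sub>R u j) = u i"
    using assms by (simp add: if_distrib[of "\<lambda>c. c *\<^sub>R _"] cong: if_cong)
  then show ?thesis using conicI[of J "\<lambda>j. if j = i then 1 else 0" u] by auto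
qed

lemma conic_minus: "conic (\<lambda>i. - u i) J = uminus ` conic u J"
  unfolding conic_def by (auto simp: sum_negf)

lemma (in pos_cone) conic_K: "(\<And>i. i \<in> J \<Longrightarrow> u i \<in> K) \<Longrightarrow> z \<in> conic u J \<Longrightarrow> z \<in> K"
  by (auto elim!: conicE intro!: K_sum K_scale)

lemma convex_chart_chart_of: "convex_chart W f \<Longrightarrow> convex_chart W (chart_of W)"
  unfolding chart_of_def by (rule someI)

text \<open>The projected cone is convex in the chart, so it contains the hull. Conversely,
  normalizing a combination \<open>z\<close> with coefficients \<open>c i\<close> exhibits it as the
  average of the normalized generators with weights
  \<open>c i * (f \<bullet> u i) / (f \<bullet> z)\<close>, so its class lies in every set competing
  in the intersection.\<close>

lemma CH_proj_pt_aux: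
  assumes f: "f = chart_of W" "convex_chart W f" and J: "finite J" "J \<noteq> {}"
    and u: "\<And>i. i \<in> J \<Longrightarrow> u i \<noteq> 0 \<and> u i \<in> closure (lift f W)"
  shows "CH W ((\<lambda>i. proj_pt (u i)) ` J) = proj_pt ` (conic u J - {0})"
proof -
  have "W \<noteq> {}" using J u by (force simp: lift_def)
  then interpret pos_cone "lift f W" f using f by (intro pos_cone_lift)
  have dom: "closure W \<subseteq> chart_dom f" using f by (simp add: convex_chart_def)
  have upos: "f \<bullet> u i > 0" if "i \<in> J" for i using u that closure_pos by blast
  have cK: "z \<in> K" if "z \<in> conic u J" for z
    by (rule conic_K[OF _ that]) (use u in auto)
  let ?R = "proj_pt ` (conic u J - {0})"
  have R: "?R \<subseteq> closure W" using cK closure_lift_iff[OF f(2)] by auto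
  have "chart f ` ?R = conic u J \<inter> {z. f \<bullet> z = 1}"
  proof (intro set_eqI iffI)
    fix x assume "x \<in> chart f ` ?R"
    then obtain z where z: "z \<in> conic u J" "z \<noteq> 0" "x = chart f (proj_pt z)" by auto
    then have "f \<bullet> z > 0" using cK closure_pos by blast
    then show "x \<in> conic u J \<inter> {z. f \<bullet> z = 1}"
      using z conic_scale[OF z(1), of "1 / (f \<bullet> z)"] by (simp add: chart_proj_pt)
  next
    fix x assume x: "x \<in> conic u J \<inter> {z. f \<bullet> z = 1}"
    then have "x = chart f (proj_pt x)" by (simp add: chart_proj_pt)
    moreover have "x \<noteq> 0" using x by auto
    ultimately show "x \<in> chart f ` ?R"
      using x by (intro image_eqI[of _ _ "proj_pt x"]) auto
  qed
  moreover have "convex (conic u J \<inter> {z. f \<bullet> z = 1})"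
    by (intro convex_Int convex_hyperplane) (auto simp: convex_def intro: conic_add conic_scale)
  ultimately have "convex (chart f ` ?R)" by simp
  moreover have "(\<lambda>i. proj_pt (u i)) ` J \<subseteq> ?R"
    using u J conic_generator by fastforce
  ultimately have 1: "CH W ((\<lambda>i. proj_pt (u i)) ` J) \<subseteq> ?R"
    unfolding CH_def f(1)[symmetric] using R by blast
  have "?R \<subseteq> C" if C: "C \<subseteq> closure W" "convex (chart f ` C)" "(\<lambda>i. proj_pt (u i)) ` J \<subseteq> C" for C
  proof
    fix p assume "p \<in> ?R"
    then obtain z where z: "z \<in> conic u J" "z \<noteq> 0" "p = proj_pt z" by auto
    then have fz: "f \<bullet> z > 0" using cK closure_pos by blast
    obtain c where c: "\<forall>i\<in>J. 0 \<le> c i" "z = (\<Sum>i\<in>J. c i *\<^sub>R u i)"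
      using z(1) by (blast elim: conicE)
    have "(\<Sum>i\<in>J. (c i * (f \<bullet> u i) / (f \<bullet> z)) *\<^sub>R ((1 / (f \<bullet> u i)) *\<^sub>R u i)) \<in> chart f ` C"
    proof (rule convex_sum[OF J(1) C(2)])
      have "(\<Sum>i\<in>J. c i * (f \<bullet> u i)) = f \<bullet> z" by (simp add: c(2) inner_sum_right)
      then show "(\<Sum>i\<in>J. c i * (f \<bullet> u i) / (f \<bullet> z)) = 1"
        using fz by (simp flip: sum_divide_distrib)
      show "0 \<le> c i * (f \<bullet> u i) / (f \<bullet> z)" if "i \<in> J" for i
        using c(1) that upos[OF that] fz by simp
      show "(1 / (f \<bullet> u i)) *\<^sub>R u i \<in> chart f ` C" if "i \<in> J" for i
        using C(3) that upos[OF that] by (force simp: chart_proj_pt[symmetric])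
    qed
    also have "(\<Sum>i\<in>J. (c i * (f \<bullet> u i) / (f \<bullet> z)) *\<^sub>R ((1 / (f \<bullet> u i)) *\<^sub>R u i))
        = (\<Sum>i\<in>J. (1 / (f \<bullet> z)) *\<^sub>R (c i *\<^sub>R u i))"
      by (rule sum.cong) (use upos in force)+
    also have "\<dots> = chart f p"
      unfolding scaleR_sum_right[symmetric] c(2)[symmetric] using fz z by (simp add: chart_proj_pt)
    finally obtain q where q: "q \<in> C" "chart f p = chart f q" by auto
    have "p \<in> chart_dom f" using fz z by (simp add: proj_pt_in_chart_dom)
    then show "p \<in> C"
      using q C(1) dom proj_pt_chart[of p f] proj_pt_chart[of q f] by auto
  qed
  then show ?thesis unfolding CH_def f(1)[symmetric] using 1[unfolded CH_def f(1)[symmetric]] by blast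
qed

text \<open>If \<open>h\<close> took both signs, the combination \<open>z\<close> chosen to kill
  \<open>h\<close> would be a nonzero vector of the closed cone whose class is outside the chart of
  \<open>h\<close>. Hence the cones defined by two charts of \<open>W\<close> agree up to a global
  sign.\<close>

lemma convex_chart_sign:
  assumes f: "convex_chart W f" and h: "convex_chart W h"
    and x: "x \<in> closure (lift f W)" and y: "y \<in> closure (lift f W)"
  shows "\<not> (h \<bullet> x > 0 \<and> h \<bullet> y < 0)"
proof
  assume *: "h \<bullet> x > 0 \<and> h \<bullet> y < 0"
  have "W \<noteq> {}" using x by (force simp: lift_def)
  then interpret pos_cone "lift f W" f using f by (intro pos_cone_lift)
  define z where "z = (- (h \<bullet> y)) *\<^sub>R x + (h \<bullet> x) *\<^sub>R y"
  have "z \<in> K" unfolding z_def using * x y by (intro K_add K_scale) auto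
  moreover have "f \<bullet> z > 0"
  proof -
    have "f \<bullet> x > 0" "f \<bullet> y > 0" using * x y closure_pos by force+
    then have "0 < (- (h \<bullet> y)) * (f \<bullet> x)" "0 < (h \<bullet> x) * (f \<bullet> y)"
      using * by (intro mult_pos_pos; simp)+
    then show ?thesis by (simp add: z_def inner_add_right inner_diff_right)
  qed
  moreover from this have "z \<noteq> 0" by auto
  ultimately have "z \<noteq> 0" "proj_pt z \<in> closure W" using closure_lift_iff[OF f, of z] by auto
  moreover have "h \<bullet> z = 0" by (simp add: z_def inner_add_right inner_diff_right)
  ultimately show False using h proj_pt_in_chart_dom[of z h] by (auto simp: convex_chart_def)
qed

text \<open>\<open>CH\<close> uses the chart selected by \<open>chart_of W\<close>, while
  \<open>f\<close> is any chart; for a face, \<open>f\<close> is inherited from the ambient domain.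
  The \<open>u i\<close> all have the same sign in the selected chart. If it is negative, passing to
  \<open>- u i\<close> changes neither the points nor the projected cone.\<close>

lemma CH_proj_pt:
  assumes f: "convex_chart W f" and J: "finite J" "J \<noteq> {}"
    and u: "\<And>i. i \<in> J \<Longrightarrow> u i \<noteq> 0 \<and> u i \<in> closure (lift f W)"
  shows "CH W ((\<lambda>i. proj_pt (u i)) ` J) = proj_pt ` (conic u J - {0})"
proof -
  define h where "h = chart_of W"
  have h: "convex_chart W h" using f unfolding h_def by (rule convex_chart_chart_of)
  have cl: "proj_pt (u i) \<in> closure W" if "i \<in> J" for i
    using u[OF that] closure_lift_iff[OF f] by blast
  have nz: "h \<bullet> u i \<noteq> 0" if "i \<in> J" for i
    using cl[OF that] u[OF that] h proj_pt_in_chart_dom[of "u i" h] by (auto simp: convex_chart_def)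
  obtain j where j: "j \<in> J" using J by auto
  show ?thesis
  proof (cases "h \<bullet> u j > 0")
    case True
    then have "h \<bullet> u i > 0" if "i \<in> J" for i
      using convex_chart_sign[OF f h, of "u j" "u i"] u[OF that] u[OF j] nz[OF that] by fastforce
    then show ?thesis
      using u cl closure_lift_iff[OF h] by (intro CH_proj_pt_aux[OF h_def h J]) auto
  next
    case False
    then have "h \<bullet> u i < 0" if "i \<in> J" for i
      using convex_chart_sign[OF f h, of "u i" "u j"] u[OF that] u[OF j] nz[OF that] nz[OF j] by fastforce
    then have "CH W ((\<lambda>i. proj_pt (- u i)) ` J) = proj_pt ` (conic (\<lambda>i. - u i) J - {0})"
      using u cl closure_lift_iff[OF h] by (intro CH_proj_pt_aux[OF h_def h J]) auto
    also have "\<dots> = proj_pt ` (uminus ` (conic u J - {0}))"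
      by (rule arg_cong[of _ _ "(`) proj_pt"]) (auto simp: conic_minus)
    also have "\<dots> = proj_pt ` (conic u J - {0})" unfolding image_image by simp
    finally show ?thesis by simp
  qed
qed

section \<open>Simplices with boundary facets\<close>

text \<open>A point of the simplex inside \<open>W\<close> lifts to a combination of lifted vertices
  \<open>w i\<close>. Absorbing its coefficients into the vectors turns it into a plain sum, and the
  facet cones of the \<open>u i\<close> are contained in those of the \<open>w i\<close>.\<close>

lemma PES_imp_cone:
  assumes f: "convex_chart W f" and P: "PES W k v"
  obtains u where "\<forall>i\<le>k. u i \<in> closure (lift f W)" "(\<Sum>i\<le>k. u i) \<in> lift f W"
    "\<forall>j\<le>k. conic u ({..k} - {j}) \<inter> lift f W = {}"
proof -
  have k: "k \<ge> 1" and vb: "\<And>i. i \<le> k \<Longrightarrow> v i \<in> pboundary W"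
    and meets: "proj_simplex W k v \<inter> W \<noteq> {}"
    and fac: "\<And>i. i \<le> k \<Longrightarrow> facet W k v i \<subseteq> pboundary W"
    using P unfolding PES_def by auto
  have "W \<noteq> {}" using meets by auto
  then interpret pos_cone "lift f W" f using f by (intro pos_cone_lift)
  have "\<exists>w. w \<noteq> 0 \<and> w \<in> closure (lift f W) \<and> v i = proj_pt w" if "i \<le> k" for i
  proof -
    have "v i \<in> closure W" using vb[OF that] by (simp add: pboundary_def)
    moreover then have "v i \<in> chart_dom f" using f by (auto simp: convex_chart_def)
    ultimately show ?thesis using closure_lift_iff[OF f]
      by (metis proj_cases_pos inner_zero_right order_less_irrefl)
  qed
  then obtain w where w: "\<And>i. i \<le> k \<Longrightarrow> w i \<noteq> 0 \<and> w i \<in> closure (lift f W) \<and> v i = proj_pt (w i)"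
    by metis
  have CH: "CH W (v ` J) = proj_pt ` (conic w J - {0})" if "J \<subseteq> {..k}" "J \<noteq> {}" for J
  proof -
    have "v ` J = (\<lambda>i. proj_pt (w i)) ` J" using that w by (intro image_cong) auto
    then show ?thesis
      using CH_proj_pt[OF f, of J w] that w finite_subset[OF that(1)] by (simp add: subset_iff)
  qed
  have wK: "z \<in> K" if "z \<in> conic w J" "J \<subseteq> {..k}" for z J
    using conic_K[OF _ that(1)] w that(2) by auto
  obtain z where z: "z \<in> conic w {..k}" "z \<noteq> 0" "proj_pt z \<in> W"
    using meets CH[of "{..k}"] by (auto simp: proj_simplex_def)
  obtain c where c: "\<forall>i\<in>{..k}. 0 \<le> c i" "z = (\<Sum>i\<le>k. c i *\<^sub>R w i)"
    using z(1) by (rule conicE)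
  define u where "u = (\<lambda>i. c i *\<^sub>R w i)"
  have "z \<in> lift f W"
    using z wK[OF z(1)] closure_pos[of z] by (simp add: lift_def)
  moreover have "\<forall>i\<le>k. u i \<in> closure (lift f W)"
    using w c(1) by (auto simp: u_def intro: K_scale)
  moreover have "conic u ({..k} - {j}) \<inter> lift f W = {}" if "j \<le> k" for j
  proof -
    have "False" if y: "y \<in> conic u ({..k} - {j})" "y \<in> lift f W" for y
    proof -
      obtain b where b: "\<forall>i\<in>{..k} - {j}. 0 \<le> b i" "y = (\<Sum>i\<in>{..k} - {j}. b i *\<^sub>R u i)"
        using y(1) by (rule conicE)
      have "(\<Sum>i\<in>{..k} - {j}. (b i * c i) *\<^sub>R w i) \<in> conic w ({..k} - {j})"
        using b(1) c(1) by (intro conicI) auto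
      then have "y \<in> conic w ({..k} - {j})" by (simp add: b(2) u_def)
      moreover have "y \<noteq> 0" using pos[OF y(2)] by auto
      moreover have "{..k} - {j} \<noteq> {}" using k by (cases j) force+
      ultimately have "proj_pt y \<in> facet W k v j"
        unfolding facet_def using CH[of "{..k} - {j}"] by auto
      then show False using fac[OF \<open>j \<le> k\<close>] y(2) by (auto simp: pboundary_def lift_def)
    qed
    then show ?thesis by blast
  qed
  ultimately show thesis using that[of u] c(2) by (simp add: u_def)
qed

text \<open>The substantial point is non-degeneracy: a nontrivial linear relation, or its negative,
  would show that the sum lies in a facet cone. The vertices are boundary points because, as
  \<open>k \<ge> 1\<close>, each of them belongs to some facet.\<close>

lemma cone_imp_PES:
  assumes f: "convex_chart W f" and k: "k \<ge> 1"
    and uK: "\<forall>i\<le>k. u i \<in> closure (lift f W)"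
    and sum: "(\<Sum>i\<le>k. u i) \<in> lift f W"
    and fac: "\<forall>j\<le>k. conic u ({..k} - {j}) \<inter> lift f W = {}"
  shows "PES W k (\<lambda>i. proj_pt (u i))"
proof -
  have "W \<noteq> {}" using sum by (auto simp: lift_def)
  then interpret pos_cone "lift f W" f using f by (intro pos_cone_lift)
  \<comment> \<open>Subtracting from the sum of the \<open>u i\<close> the largest multiple of a linear relation that keeps
    all coefficients nonnegative would move the sum into a facet.\<close>
  have nonpos: "\<forall>i\<le>k. b i \<le> 0" if b: "(\<Sum>i\<le>k. b i *\<^sub>R u i) = 0" for b
  proof (rule ccontr)
    assume "\<not> ?thesis"
    then obtain i where "i \<le> k" "b i > 0" by (auto simp: not_le)
    then have ex: "{i. i \<le> k \<and> b i > 0} \<noteq> {}" by blast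
    define M where "M = Max (b ` {i. i \<le> k \<and> b i > 0})"
    have "M \<in> b ` {i. i \<le> k \<and> b i > 0}" unfolding M_def using ex by (intro Max_in) auto
    then obtain j where j: "j \<le> k" "b j = M" "M > 0" by auto
    have le: "b i \<le> M" if "i \<le> k" for i
    proof (cases "b i > 0")
      case True
      then show ?thesis unfolding M_def using that by (intro Max_ge) auto
    qed (use j in auto)
    have "(\<Sum>i\<le>k. u i) = (\<Sum>i\<le>k. u i) - (1 / M) *\<^sub>R (\<Sum>i\<le>k. b i *\<^sub>R u i)" using b by simp
    also have "\<dots> = (\<Sum>i\<le>k. (1 - b i / M) *\<^sub>R u i)"
      by (simp add: scaleR_sum_right sum_subtractf algebra_simps)
    also have "\<dots> = (\<Sum>i\<in>{..k} - {j}. (1 - b i / M) *\<^sub>R u i)"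
      using j by (intro sum.mono_neutral_right) auto
    also have "\<dots> \<in> conic u ({..k} - {j})"
      using le j by (intro conicI) (auto simp: field_simps)
    finally show False using fac j sum by blast
  qed
  have ind0: "\<forall>i\<le>k. b i = 0" if "(\<Sum>i\<le>k. b i *\<^sub>R u i) = 0" for b
  proof -
    have "(\<Sum>i\<le>k. (- b i) *\<^sub>R u i) = 0" using that by (simp add: sum_negf)
    then show ?thesis using nonpos[of b] nonpos[of "\<lambda>i. - b i"] that by (metis neg_le_0_iff_le order_antisym)
  qed
  have inj: "inj_on u {..k}"
  proof (rule inj_onI, rule ccontr)
    fix i j assume ij: "i \<in> {..k}" "j \<in> {..k}" "u i = u j" "i \<noteq> j"
    have "(\<Sum>l\<le>k. ((if l = i then 1 else 0) - (if l = j then 1 else 0)) *\<^sub>R u l) = u i - u j"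
      using ij by (simp add: scaleR_diff_left sum_subtractf if_distrib[of "\<lambda>c. c *\<^sub>R _"] cong: if_cong)
    then show False using ind0[of "\<lambda>l. (if l = i then 1 else 0) - (if l = j then 1 else 0)"] ij by auto
  qed
  have nz: "u i \<noteq> 0" if "i \<le> k" for i
  proof
    assume "u i = 0"
    then have "(\<Sum>l\<le>k. (if l = i then 1 else 0) *\<^sub>R u l) = 0" by (intro sum.neutral) auto
    from ind0[OF this] that show False by auto
  qed
  have indep: "independent (u ` {..k})"
  proof (rule independent_if_scalars_zero)
    fix g x assume g: "(\<Sum>x\<in>u ` {..k}. g x *\<^sub>R x) = 0" and x: "x \<in> u ` {..k}"
    then have "(\<Sum>i\<le>k. g (u i) *\<^sub>R u i) = 0" using inj by (simp add: sum.reindex)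
    then show "g x = 0" using ind0[of "\<lambda>i. g (u i)"] x by auto
  qed auto
  have "lin_span ((\<lambda>i. proj_pt (u i)) ` {..k}) = span (u ` {..k})"
  proof -
    have "line_of (proj_pt (u i)) = span {u i}" if "i \<le> k" for i
      using nz[OF that] by (rule line_of_proj_pt)
    then have "(\<Union>p\<in>(\<lambda>i. proj_pt (u i)) ` {..k}. line_of p) = (\<Union>x\<in>u ` {..k}. span {x})" by simp
    then have eq: "lin_span ((\<lambda>i. proj_pt (u i)) ` {..k}) = span (\<Union>x\<in>u ` {..k}. span {x})"
      by (simp only: lin_span_def)
    have "(\<Union>x\<in>u ` {..k}. span {x}) \<subseteq> span (u ` {..k})"
      by (intro UN_least span_mono) auto
    moreover have "u ` {..k} \<subseteq> (\<Union>x\<in>u ` {..k}. span {x})" by (auto intro: span_base)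
    ultimately show ?thesis unfolding eq
      by (intro subset_antisym span_mono span_minimal subspace_span)
  qed
  then have nd: "nondegenerate k (\<lambda>i. proj_pt (u i))"
    using indep inj by (simp add: nondegenerate_def dim_eq_card_independent card_image)
  have CH: "CH W ((\<lambda>i. proj_pt (u i)) ` J) = proj_pt ` (conic u J - {0})"
    if "J \<subseteq> {..k}" "J \<noteq> {}" for J
    using CH_proj_pt[OF f, of J u] that uK nz finite_subset[OF that(1)] by (simp add: subset_iff)
  have ne: "{..k} - {j} \<noteq> {}" for j using k by (cases j) force+
  have facets: "facet W k (\<lambda>i. proj_pt (u i)) j \<subseteq> pboundary W" if "j \<le> k" for j
  proof
    fix p assume "p \<in> facet W k (\<lambda>i. proj_pt (u i)) j"
    then obtain z where z: "z \<in> conic u ({..k} - {j})" "z \<noteq> 0" "p = proj_pt z"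
      unfolding facet_def using CH[of "{..k} - {j}"] ne by auto
    have "z \<in> K" by (rule conic_K[OF _ z(1)]) (use uK in auto)
    then have "f \<bullet> z > 0" "proj_pt z \<in> closure W" using closure_lift_iff[OF f z(2)] by auto
    then show "p \<in> pboundary W" using fac that z by (auto simp: pboundary_def lift_def)
  qed
  have "proj_pt (u i) \<in> pboundary W" if "i \<le> k" for i
  proof -
    obtain j where j: "j \<le> k" "j \<noteq> i" using ne[of i] by auto
    have "u i \<in> conic u ({..k} - {j})" using that j by (intro conic_generator) auto
    then have "proj_pt (u i) \<in> facet W k (\<lambda>i. proj_pt (u i)) j"
      unfolding facet_def using CH[of "{..k} - {j}"] ne nz[OF that] by auto
    then show ?thesis using facets j by auto
  qed
  moreover have "(\<Sum>i\<le>k. u i) \<in> conic u {..k}"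
    using conicI[of "{..k}" "\<lambda>_. 1" u] by simp
  then have "proj_pt (\<Sum>i\<le>k. u i) \<in> proj_simplex W k (\<lambda>i. proj_pt (u i))"
    using CH[of "{..k}"] pos[OF sum] by (auto simp: proj_simplex_def)
  ultimately show ?thesis
    unfolding PES_def using k nd facets sum by (auto simp: lift_def)
qed

section \<open>Limits of simplicial cones\<close>

text \<open>Induction on \<open>k\<close>: a subsequence that works up to index \<open>k\<close> is
  thinned once more for index \<open>Suc k\<close>.\<close>

lemma compact_simultaneous_subseq:
  fixes x :: "nat \<Rightarrow> nat \<Rightarrow> 'a::metric_space"
  assumes D: "compact D" and x: "\<And>n i. i \<le> k \<Longrightarrow> x n i \<in> D"
  shows "\<exists>r l. strict_mono r \<and> (\<forall>i\<le>k. l i \<in> D \<and> (\<lambda>n. x (r n) i) \<longlonglongrightarrow> l i)"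
  using x
proof (induction k)
  case 0
  then obtain l r where "l \<in> D" "strict_mono r" "((\<lambda>n. x n 0) \<circ> r) \<longlonglongrightarrow> l"
    using D unfolding compact_def by (metis order_refl)
  then show ?case by (intro exI[of _ r] exI[of _ "\<lambda>_. l"]) (auto simp: o_def)
next
  case (Suc k)
  then obtain r l where r: "strict_mono r" "\<forall>i\<le>k. l i \<in> D \<and> (\<lambda>n. x (r n) i) \<longlonglongrightarrow> l i"
    by (meson le_SucI)
  have "\<forall>n. x (r n) (Suc k) \<in> D" using Suc.prems by simp
  then obtain m s where s: "m \<in> D" "strict_mono s" "((\<lambda>n. x (r n) (Suc k)) \<circ> s) \<longlonglongrightarrow> m"
    using D unfolding compact_def by meson
  have "(\<lambda>n. x (r (s n)) i) \<longlonglongrightarrow> l i" if "i \<le> k" for i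
    using LIMSEQ_subseq_LIMSEQ[of "\<lambda>n. x (r n) i" "l i" s] r(2) s(2) that by (auto simp: o_def)
  then show ?case
    using r s by (intro exI[of _ "r \<circ> s"] exI[of _ "l(Suc k := m)"])
      (auto simp: strict_mono_def le_Suc_eq o_def)
qed

lemma conic_sum: "(\<And>l. l \<in> L \<Longrightarrow> x l \<in> conic u J) \<Longrightarrow> sum x L \<in> conic u J"
proof (induction L rule: infinite_finite_induct)
  case (insert a L)
  then show ?case by (auto intro: conic_add)
qed (use conicI[of J "\<lambda>_. 0" u] in auto)

section \<open>Faces of a cone in terms of domination\<close>

context pos_cone
begin

text \<open>For elements of \<open>K\<close>, this says that they lie in the relative interior of
  the same face of \<open>K\<close>: each dominates a positive multiple of the other in the order
  defined by the cone.\<close>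

definition face_eq where
  "face_eq x y \<longleftrightarrow> (\<exists>e>0. x - e *\<^sub>R y \<in> K \<and> y - e *\<^sub>R x \<in> K)"

lemma face_eq_refl: "x \<in> K \<Longrightarrow> face_eq x x"
  unfolding face_eq_def by (rule exI[of _ 1]) (simp add: zero_K)

lemma face_eq_sym: "face_eq x y \<Longrightarrow> face_eq y x"
  unfolding face_eq_def by blast

lemma face_eq_trans: assumes "face_eq x y" "face_eq y z" shows "face_eq x z"
proof -
  obtain d where d: "d > 0" "x - d *\<^sub>R y \<in> K" "y - d *\<^sub>R x \<in> K"
    using assms(1) unfolding face_eq_def by blast
  obtain e where e: "e > 0" "y - e *\<^sub>R z \<in> K" "z - e *\<^sub>R y \<in> K"
    using assms(2) unfolding face_eq_def by blast
  have "(x - d *\<^sub>R y) + d *\<^sub>R (y - e *\<^sub>R z) \<in> K" "(z - e *\<^sub>R y) + e *\<^sub>R (y - d *\<^sub>R x) \<in> K"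
    using d e by (intro K_add K_scale; simp)+
  then show ?thesis unfolding face_eq_def using d e
    by (intro exI[of _ "d * e"]) (simp add: algebra_simps)
qed

lemma face_eq_scale: assumes "x \<in> K" "c > 0" shows "face_eq (c *\<^sub>R x) x"
proof -
  define e where "e = min c (1 / c)"
  have "e > 0" "e \<le> c" "e * c \<le> 1"
    using assms by (auto simp: e_def min_def field_simps)
  moreover have "c *\<^sub>R x - e *\<^sub>R x = (c - e) *\<^sub>R x" "x - e *\<^sub>R c *\<^sub>R x = (1 - e * c) *\<^sub>R x"
    by (auto simp: algebra_simps)
  ultimately show ?thesis
    unfolding face_eq_def using assms by (intro exI[of _ e]) (auto intro: K_scale)
qed

lemma face_eqI:
  assumes "x - d *\<^sub>R y \<in> K" "y - e *\<^sub>R x \<in> K" "0 < d" "0 < e" "x \<in> K" "y \<in> K"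
  shows "face_eq x y"
proof -
  have "(x - d *\<^sub>R y) + (d - min d e) *\<^sub>R y \<in> K" "(y - e *\<^sub>R x) + (e - min d e) *\<^sub>R x \<in> K"
    using assms by (intro K_add K_scale; simp)+
  then show ?thesis unfolding face_eq_def using assms
    by (intro exI[of _ "min d e"]) (simp add: algebra_simps)
qed

text \<open>\<open>M\<close> is one more than the sum of the coefficients of \<open>z\<close>, so it
  exceeds each of them and stays positive when they all vanish. The sum of the generators thus
  stands for the whole generated cone in questions of domination.\<close>

lemma conic_dominated:
  assumes J: "finite J" and u: "\<And>i. i \<in> J \<Longrightarrow> u i \<in> K" and z: "z \<in> conic u J"
  obtains M where "M > 0" "M *\<^sub>R sum u J - z \<in> K"
proof -
  obtain c where c: "\<forall>i\<in>J. 0 \<le> c i" "z = (\<Sum>i\<in>J. c i *\<^sub>R u i)" using z by (rule conicE)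
  have "(1 + sum c J) *\<^sub>R sum u J - z = (\<Sum>i\<in>J. (1 + sum c J - c i) *\<^sub>R u i)"
    by (simp add: c(2) scaleR_sum_right sum_subtractf algebra_simps sum.distrib)
  moreover have "c i \<le> sum c J" if "i \<in> J" for i using c(1) J that by (intro member_le_sum) auto
  then have "(\<Sum>i\<in>J. (1 + sum c J - c i) *\<^sub>R u i) \<in> K"
    using u by (intro K_sum K_scale) force+
  moreover have "sum c J \<ge> 0" using c(1) by (auto intro: sum_nonneg)
  ultimately show thesis using that[of "1 + sum c J"] by simp
qed

end

section \<open>Open cones and maximal coefficients\<close>

locale open_cone = pos_cone +
  assumes open_I: "open I"
begin

text \<open>\<open>y\<close> is replaced by a nearby \<open>y'\<close> in \<open>I\<close>, and the
  error is absorbed by a ball around \<open>x\<close> inside \<open>I\<close>.\<close>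

lemma I_K_add: assumes "x \<in> I" "y \<in> K" shows "x + y \<in> I"
proof -
  obtain e where e: "e > 0" "ball x e \<subseteq> I" using open_I assms(1) open_contains_ball by blast
  obtain y' where y': "y' \<in> I" "dist y' y < e" using assms(2) e(1) closure_approachable by blast
  have "x + (y - y') \<in> I" using e y' by (auto simp: dist_norm norm_minus_commute)
  from add[OF this y'(1)] show ?thesis by simp
qed

lemma K_I_add: "x \<in> K \<Longrightarrow> y \<in> I \<Longrightarrow> x + y \<in> I"
  using I_K_add[of y x] by (simp add: add.commute)

lemma I_diff_K: "y - x \<in> K \<Longrightarrow> x \<in> I \<Longrightarrow> y \<in> I"
  using I_K_add[of x "y - x"] by simp

lemma I_minus: assumes "x \<in> I" obtains e where "e > 0" "x - e *\<^sub>R y \<in> I"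
proof -
  have "((\<lambda>e. x - e *\<^sub>R y) \<longlongrightarrow> x - 0 *\<^sub>R y) (at_right 0)" by (intro tendsto_intros)
  then have "\<forall>\<^sub>F e in at_right 0. x - e *\<^sub>R y \<in> I"
    using topological_tendstoD[OF _ open_I] assms by force
  moreover have "\<forall>\<^sub>F e in at_right (0::real). e > 0" by (rule eventually_at_right_less)
  ultimately have "\<forall>\<^sub>F e in at_right 0. e > 0 \<and> x - e *\<^sub>R y \<in> I" by eventually_elim simp
  then show thesis using that eventually_happens'[OF trivial_limit_at_right_real] by blast
qed

text \<open>The admissible coefficients form a closed set, which contains a positive number since
  \<open>x\<close> is interior and is bounded above through \<open>f\<close>. Its maximum marks
  where the ray from \<open>x\<close> in direction \<open>- v\<close> leaves
  \<open>K\<close>.\<close>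

lemma max_coeff:
  assumes "x \<in> I" "v \<in> K" "v \<noteq> 0"
  obtains m where "m > 0" "x - m *\<^sub>R v \<in> K" "\<And>m'. x - m' *\<^sub>R v \<in> K \<Longrightarrow> m' \<le> m"
proof -
  define S where "S = (\<lambda>m. x - m *\<^sub>R v) -` K"
  obtain e where e: "e > 0" "x - e *\<^sub>R v \<in> I" using assms(1) by (rule I_minus)
  have fv: "f \<bullet> v > 0" using assms closure_pos by blast
  have "closed S" unfolding S_def
    by (intro closed_vimage closed_closure continuous_intros)
  moreover have bdd: "bdd_above S"
  proof (rule bdd_aboveI)
    fix m assume "m \<in> S"
    then have "0 \<le> f \<bullet> (x - m *\<^sub>R v)" unfolding S_def using K_nonneg by simp
    then show "m \<le> (f \<bullet> x) / (f \<bullet> v)" using fv by (simp add: inner_diff_right field_simps)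
  qed
  moreover have eS: "e \<in> S" using e I_K by (simp add: S_def)
  ultimately have "Sup S \<in> S" by (intro closed_contains_Sup) auto
  moreover have "e \<le> Sup S" using eS bdd by (rule cSup_upper)
  ultimately show thesis
    using that[of "Sup S"] e cSup_upper[OF _ bdd] by (auto simp: S_def)
qed

text \<open>The cone version of a PES. Per facet only the sum of its generators is tested, which
  suits limits; \<open>simplicial_iff_conic\<close> shows that this controls the entire
  facet.\<close>

definition simplicial :: "nat \<Rightarrow> (nat \<Rightarrow> 'a) \<Rightarrow> bool" where
  "simplicial k u \<longleftrightarrow> (\<forall>i\<le>k. u i \<in> K) \<and> (\<Sum>i\<le>k. u i) \<in> I \<and> (\<forall>j\<le>k. (\<Sum>i\<le>k. u i) - u j \<notin> I)"

text \<open>A large multiple of the sum dominates \<open>z\<close>, and whatever dominates an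
  element of \<open>I\<close> belongs to \<open>I\<close>.\<close>

lemma conic_I:
  assumes J: "finite J" and u: "\<And>i. i \<in> J \<Longrightarrow> u i \<in> K" and z: "z \<in> conic u J" "z \<in> I"
  shows "sum u J \<in> I"
proof -
  obtain M where M: "M > 0" "M *\<^sub>R sum u J - z \<in> K" using J u z(1) by (rule conic_dominated)
  have "M *\<^sub>R sum u J \<in> I" using M(2) z(2) by (rule I_diff_K)
  from scale[OF this, of "1 / M"] show ?thesis using M by simp
qed

lemma simplicial_iff_conic:
  "simplicial k u \<longleftrightarrow> (\<forall>i\<le>k. u i \<in> K) \<and> (\<Sum>i\<le>k. u i) \<in> I \<and>
     (\<forall>j\<le>k. conic u ({..k} - {j}) \<inter> I = {})"
proof -
  have "conic u ({..k} - {j}) \<inter> I = {} \<longleftrightarrow> (\<Sum>i\<le>k. u i) - u j \<notin> I"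
    if uK: "\<forall>i\<le>k. u i \<in> K" and j: "j \<le> k" for j
  proof -
    have eq: "(\<Sum>i\<le>k. u i) - u j = sum u ({..k} - {j})" using j by (simp add: sum_diff1)
    have "sum u ({..k} - {j}) \<in> conic u ({..k} - {j})"
      using conicI[of "{..k} - {j}" "\<lambda>_. 1" u] by simp
    moreover have "sum u ({..k} - {j}) \<in> I" if "z \<in> conic u ({..k} - {j})" "z \<in> I" for z
      by (rule conic_I[OF _ _ that]) (use uK in auto)
    ultimately show ?thesis unfolding eq by blast
  qed
  then show ?thesis unfolding simplicial_def by (intro conj_cong refl) simp
qed

text \<open>\<open>T\<close> is a rescaled lift of the inverse of the automorphism that maps a point of the compact
  set to the point represented by \<open>z\<close>.\<close>

definition quasi_homogeneous_cone where
  "quasi_homogeneous_cone \<longleftrightarrow> (\<exists>B. compact B \<and> B \<subseteq> I \<and>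
     (\<forall>z\<in>I. \<exists>T. linear T \<and> T z \<in> B \<and> T ` K \<subseteq> K \<and> (\<forall>v. T v \<in> I \<longrightarrow> v \<in> I)))"

text \<open>The maps \<open>T n\<close> bring the sums into the compact set \<open>B\<close>. This
  bounds \<open>f\<close> on every summand, hence the summands, and a subsequence converges to
  vectors \<open>u i\<close> whose sum is in \<open>B\<close>. The hypothesis \<open>far\<close>
  keeps the sum without \<open>u j\<close> out of \<open>I\<close>.\<close>

lemma rescaling:
  assumes qh: quasi_homogeneous_cone
    and w: "\<And>n i. i \<le> k \<Longrightarrow> w n i \<in> K"
    and z: "\<And>n. (\<Sum>i\<le>k. w n i) \<in> I"
    and far: "\<And>j e. j \<le> k \<Longrightarrow> e > 0 \<Longrightarrow>
      \<forall>\<^sub>F n in sequentially. (\<Sum>i\<le>k. w n i) - w n j - e *\<^sub>R (\<Sum>i\<le>k. w n i) \<notin> I"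
  shows "\<exists>u. simplicial k u"
proof -
  obtain B where B: "compact B" "B \<subseteq> I"
    and *: "\<forall>z\<in>I. \<exists>T. linear T \<and> T z \<in> B \<and> T ` K \<subseteq> K \<and> (\<forall>v. T v \<in> I \<longrightarrow> v \<in> I)"
    using qh unfolding quasi_homogeneous_cone_def by blast
  have "\<forall>n. \<exists>T. linear T \<and> T (\<Sum>i\<le>k. w n i) \<in> B \<and> T ` K \<subseteq> K \<and> (\<forall>v. T v \<in> I \<longrightarrow> v \<in> I)"
    using * z by blast
  then obtain T where T: "\<And>n. linear (T n)" "\<And>n. T n (\<Sum>i\<le>k. w n i) \<in> B"
    "\<And>n. T n ` K \<subseteq> K" "\<And>n v. T n v \<in> I \<Longrightarrow> v \<in> I"
    by metis
  define x where "x = (\<lambda>n i. T n (w n i))"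
  have sumx: "T n (\<Sum>i\<le>k. w n i) = (\<Sum>i\<le>k. x n i)" for n
    by (simp add: x_def linear_sum[OF T(1)])
  have xK: "x n i \<in> K" if "i \<le> k" for n i using T(3)[of n] w[OF that, of n] by (auto simp: x_def)
  obtain c where c: "c > 0" "\<forall>x\<in>K. norm x \<le> c * (f \<bullet> x)" using norm_le by blast
  obtain M where M: "\<And>x. x \<in> B \<Longrightarrow> norm x \<le> M"
    using compact_imp_bounded[OF B(1)] unfolding bounded_iff by blast
  have "norm (x n i) \<le> c * (norm f * M)" if "i \<le> k" for n i
  proof -
    have "norm (x n i) \<le> c * (f \<bullet> x n i)" using c xK that by blast
    also have "f \<bullet> x n i \<le> (\<Sum>i\<le>k. f \<bullet> x n i)"
      using that xK K_nonneg by (intro member_le_sum) auto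
    also have "\<dots> = f \<bullet> (\<Sum>i\<le>k. x n i)" by (simp add: inner_sum_right)
    also have "\<dots> \<le> norm f * norm (\<Sum>i\<le>k. x n i)" by (rule norm_cauchy_schwarz)
    also have "\<dots> \<le> norm f * M" using M[OF T(2)[of n]] by (simp add: sumx mult_left_mono)
    finally show ?thesis using c by simp
  qed
  then have xD: "x n i \<in> K \<inter> cball 0 (c * (norm f * M))" if "i \<le> k" for n i
    using xK that by auto
  have "compact (K \<inter> cball 0 (c * (norm f * M)))" by (simp add: closed_Int_compact)
  then obtain r u where r: "strict_mono r" and u: "\<forall>i\<le>k. u i \<in> K \<and> (\<lambda>n. x (r n) i) \<longlonglongrightarrow> u i"
    using compact_simultaneous_subseq[where k = k and x = x, OF _ xD] by blast
  have lim: "(\<lambda>n. \<Sum>i\<le>k. x (r n) i) \<longlonglongrightarrow> (\<Sum>i\<le>k. u i)"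
    using u by (intro tendsto_sum) auto
  have "(\<Sum>i\<le>k. u i) \<in> B"
    by (rule closed_sequentially[OF compact_imp_closed[OF B(1)] _ lim]) (metis T(2) sumx)
  then have sumI: "(\<Sum>i\<le>k. u i) \<in> I" using B by blast
  have "(\<Sum>i\<le>k. u i) - u j \<notin> I" if j: "j \<le> k" for j
  proof
    assume "(\<Sum>i\<le>k. u i) - u j \<in> I"
    \<comment> \<open>Openness at the limit leaves room for a fixed \<open>e\<close>. For large
      \<open>n\<close> the images inherit this, and pulling back through \<open>T (r n)\<close>
      contradicts \<open>far\<close>.\<close>
    then obtain e where e: "e > 0" "(\<Sum>i\<le>k. u i) - u j - e *\<^sub>R (\<Sum>i\<le>k. u i) \<in> I" by (rule I_minus)
    have "(\<lambda>n. (\<Sum>i\<le>k. x (r n) i) - x (r n) j - e *\<^sub>R (\<Sum>i\<le>k. x (r n) i))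
        \<longlonglongrightarrow> (\<Sum>i\<le>k. u i) - u j - e *\<^sub>R (\<Sum>i\<le>k. u i)"
      using u j by (intro tendsto_diff tendsto_scaleR tendsto_const lim) auto
    from topological_tendstoD[OF this open_I e(2)]
    have "\<forall>\<^sub>F n in sequentially. (\<Sum>i\<le>k. w (r n) i) - w (r n) j - e *\<^sub>R (\<Sum>i\<le>k. w (r n) i) \<in> I"
    proof eventually_elim
      case (elim n)
      have "T (r n) ((\<Sum>i\<le>k. w (r n) i) - w (r n) j - e *\<^sub>R (\<Sum>i\<le>k. w (r n) i)) \<in> I"
        using elim by (simp add: linear_diff[OF T(1)] linear_scale[OF T(1)] sumx)
          (simp add: x_def)
      then show ?case by (rule T(4))
    qed
    moreover have "\<forall>\<^sub>F n in sequentially. (\<Sum>i\<le>k. w (r n) i) - w (r n) j - e *\<^sub>R (\<Sum>i\<le>k. w (r n) i) \<notin> I"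
      using eventually_subseq[OF r far[OF j e(1)]] .
    ultimately have "\<forall>\<^sub>F n in sequentially. False" by eventually_elim simp
    then show False by simp
  qed
  then show ?thesis unfolding simplicial_def using u sumI by blast
qed

text \<open>The given vectors span a simplex in a proper face of \<open>K\<close>. A new vertex in
  direction \<open>p\<close>, shrinking to zero, moves their sum \<open>y\<close> into
  \<open>I\<close>. The facet opposite the new vertex stays in the boundary, and the others approach
  faces smaller than that of \<open>y\<close>.\<close>

lemma simplicial_of_face:
  assumes qh: quasi_homogeneous_cone
    and u: "\<And>i. i \<le> k \<Longrightarrow> u i \<in> K"
    and y: "(\<Sum>i\<le>k. u i) \<notin> I"
    and fac: "\<And>j. j \<le> k \<Longrightarrow> \<not> face_eq ((\<Sum>i\<le>k. u i) - u j) (\<Sum>i\<le>k. u i)"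
  shows "\<exists>u. simplicial (Suc k) u"
proof -
  obtain p where p: "p \<in> I" using nonempty by auto
  define y where "y = (\<Sum>i\<le>k. u i)"
  define a where "a = (\<lambda>n. inverse (real (Suc n)))"
  \<comment> \<open>Index 0 is the new vertex; the given vectors are shifted by one.\<close>
  define w where "w = (\<lambda>n i. case i of 0 \<Rightarrow> a n *\<^sub>R p | Suc i \<Rightarrow> u i)"
  have apos: "a n > 0" for n by (simp add: a_def)
  have a0: "a \<longlonglongrightarrow> 0" unfolding a_def by (rule LIMSEQ_inverse_real_of_nat)
  have yK: "y \<in> K" unfolding y_def using u by (intro K_sum) auto
  have sum: "(\<Sum>i\<le>Suc k. w n i) = a n *\<^sub>R p + y" for n
    by (simp only: sum.atMost_Suc_shift) (simp add: w_def y_def)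
  show ?thesis
  proof (rule rescaling[OF qh])
    show "w n i \<in> K" if "i \<le> Suc k" for n i
      using that u p apos[of n] by (auto simp: w_def less_imp_le intro!: K_scale intro: I_K split: nat.split)
    show "(\<Sum>i\<le>Suc k. w n i) \<in> I" for n
      unfolding sum using p apos yK by (intro I_K_add scale)
    fix j and e :: real assume j: "j \<le> Suc k" and e: "e > 0"
    show "\<forall>\<^sub>F n in sequentially. (\<Sum>i\<le>Suc k. w n i) - w n j - e *\<^sub>R (\<Sum>i\<le>Suc k. w n i) \<notin> I"
    proof (cases j)
      case 0
      \<comment> \<open>Adding back the multiple of \<open>p\<close> would put a positive multiple
        of \<open>y\<close> into \<open>I\<close>.\<close>
      have "y - e *\<^sub>R (a n *\<^sub>R p + y) \<notin> I" for n
      proof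
        assume I: "y - e *\<^sub>R (a n *\<^sub>R p + y) \<in> I"
        have "y - e *\<^sub>R (a n *\<^sub>R p + y) + (e * a n) *\<^sub>R p \<in> I"
          using I p e apos[of n] by (intro add scale) auto
        then have *: "(1 - e) *\<^sub>R y \<in> I" by (simp add: algebra_simps)
        then have "(1 - e) * (f \<bullet> y) > 0" using pos by fastforce
        then have "1 - e > 0" using K_nonneg[OF yK] by (simp add: zero_less_mult_iff)
        then show False using scale[OF *, of "1 / (1 - e)"] assms(3) by (simp add: y_def)
      qed
      then show ?thesis unfolding sum using 0 by (simp add: w_def)
    next
      case (Suc i)
      then have i: "i \<le> k" using j by simp
      have "y - u i = sum u ({..k} - {i})" using i by (simp add: y_def sum_diff1)
      then have qK: "y - u i \<in> K" using u by (auto intro: K_sum)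
      \<comment> \<open>Since \<open>y\<close> dominates \<open>y - u i\<close> anyway, the converse
        domination would make them face-equivalent. As \<open>K\<close> is closed, non-membership
        persists for vectors near this limit.\<close>
      have "y - u i - e *\<^sub>R y \<notin> K"
      proof
        assume "y - u i - e *\<^sub>R y \<in> K"
        moreover have "y - 1 *\<^sub>R (y - u i) \<in> K" using u i by simp
        ultimately have "face_eq (y - u i) y" using e qK yK by (intro face_eqI[of _ e _ 1]) auto
        then show False using fac[OF i] by (simp add: y_def)
      qed
      moreover have "(\<lambda>n. a n *\<^sub>R p + y - u i - e *\<^sub>R (a n *\<^sub>R p + y))
          \<longlonglongrightarrow> 0 *\<^sub>R p + y - u i - e *\<^sub>R (0 *\<^sub>R p + y)"
        by (intro tendsto_intros a0)
      ultimately have "\<forall>\<^sub>F n in sequentially. a n *\<^sub>R p + y - u i - e *\<^sub>R (a n *\<^sub>R p + y) \<in> - K"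
        by (intro topological_tendstoD[of _ _ _ "- K"]) auto
      then show ?thesis unfolding sum using Suc I_K by (auto simp: w_def elim!: eventually_mono)
    qed
  qed
qed

lemma simplicial_nonzero: assumes "simplicial k u" "i \<le> k" shows "u i \<noteq> 0"
  using assms unfolding simplicial_def by force

text \<open>\<open>y\<close> is an interior point of the facet opposite \<open>u 0\<close>, and the
  remaining vectors are to form a simplex in its face. If some \<open>z\<close> avoiding
  \<open>u (Suc j)\<close> were equivalent to \<open>y\<close>, the sum of the other generators of
  the facet would dominate a multiple of \<open>y\<close>; adding \<open>u 0\<close> would put a
  forbidden sum into \<open>I\<close>.\<close>

lemma face_of_simplicial:
  assumes s: "simplicial (Suc k) u" and k: "k \<ge> 1"
  defines "y \<equiv> \<Sum>i\<le>k. u (Suc i)"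
  shows "y \<in> K" "y \<noteq> 0" "y \<notin> I"
    and "\<And>j z. j \<le> k \<Longrightarrow> z \<in> conic (\<lambda>i. u (Suc i)) ({..k} - {j}) \<Longrightarrow> \<not> face_eq z y"
proof -
  have uK: "\<And>i. i \<le> Suc k \<Longrightarrow> u i \<in> K" and uI: "(\<Sum>i\<le>Suc k. u i) \<in> I"
    and fac: "\<And>j. j \<le> Suc k \<Longrightarrow> (\<Sum>i\<le>Suc k. u i) - u j \<notin> I"
    using s unfolding simplicial_def by auto
  have sum: "(\<Sum>i\<le>Suc k. u i) = u 0 + y" unfolding y_def by (rule sum.atMost_Suc_shift)
  note uI = uI[unfolded sum] and fac = fac[unfolded sum]
  show yK: "y \<in> K" unfolding y_def using uK by (intro K_sum) auto
  show "y \<notin> I" using fac[of 0] by simp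
  show "y \<noteq> 0"
  proof
    assume "y = 0"
    have "f \<bullet> u (Suc 0) \<le> (\<Sum>i\<le>k. f \<bullet> u (Suc i))"
      using K_nonneg uK by (intro member_le_sum[of 0]) auto
    also have "\<dots> = f \<bullet> y" by (simp add: y_def inner_sum_right)
    finally show False
      using \<open>y = 0\<close> closure_pos[OF uK, of "Suc 0"] simplicial_nonzero[OF s, of "Suc 0"] by simp
  qed
  fix j z assume j: "j \<le> k" and z: "z \<in> conic (\<lambda>i. u (Suc i)) ({..k} - {j})"
  show "\<not> face_eq z y"
  proof
    assume "face_eq z y"
    then obtain e where e: "e > 0" "z - e *\<^sub>R y \<in> K" unfolding face_eq_def by blast
    obtain M where M: "M > 0" "M *\<^sub>R (\<Sum>i\<in>{..k} - {j}. u (Suc i)) - z \<in> K"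
      by (rule conic_dominated[OF _ _ z]) (use uK in auto)
    have q: "(\<Sum>i\<in>{..k} - {j}. u (Suc i)) = y - u (Suc j)"
      using j by (simp add: y_def sum_diff1)
    define d where "d = min M e"
    have d: "d > 0" "d \<le> M" "d \<le> e" using M e by (auto simp: d_def)
    \<comment> \<open>The vector equals
      \<open>M *\<^sub>R (u 0 + y - u (Suc j)) - d *\<^sub>R (u 0 + y)\<close>.\<close>
    have "(M *\<^sub>R (y - u (Suc j)) - z) + (z - e *\<^sub>R y) + (e - d) *\<^sub>R y + (M - d) *\<^sub>R u 0 \<in> K"
      using M(2) e(2) d yK uK q by (intro K_add K_scale) auto
    from I_K_add[OF scale[OF uI d(1)] this]
    have "M *\<^sub>R (u 0 + y - u (Suc j)) \<in> I" by (simp add: algebra_simps)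
    from scale[OF this, of "1 / M"] show False using fac[of "Suc j"] j M(1) by simp
  qed
qed

text \<open>In terms of the Hilbert metric, \<open>thick\<close> puts the sum of the
  \<open>p n i\<close> at distance at least \<open>n\<close> from the points obtained from
  \<open>v n\<close> and the sum with one \<open>p n i\<close> left out. For a suitable
  \<open>t\<close>, the point \<open>v n\<close> plus \<open>t\<close> times the sum is far from
  every facet: from the one opposite \<open>v n\<close> by maximality of \<open>m\<close>, from the
  others by \<open>thick\<close>.\<close>

lemma simplicial_of_thick:
  assumes qh: quasi_homogeneous_cone
    and v: "\<And>n. v n \<in> I" and p: "\<And>n i. i \<le> k \<Longrightarrow> p n i \<in> K" and x: "\<And>n. (\<Sum>i\<le>k. p n i) \<in> I"
    and thick: "\<And>n i t a b. i \<le> k \<Longrightarrow> 0 < t \<Longrightarrow> 0 < a \<Longrightarrow> 0 < b \<Longrightarrow>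
      (v n + t *\<^sub>R ((\<Sum>i\<le>k. p n i) - p n i)) - a *\<^sub>R (\<Sum>i\<le>k. p n i) \<in> K \<Longrightarrow>
      (\<Sum>i\<le>k. p n i) - b *\<^sub>R (v n + t *\<^sub>R ((\<Sum>i\<le>k. p n i) - p n i)) \<in> K \<Longrightarrow>
      a * b \<le> exp (- 2 * real n)"
  shows "\<exists>u. simplicial (Suc k) u"
proof -
  define x where "x = (\<lambda>n. \<Sum>i\<le>k. p n i)"
  have "\<exists>m>0. x n - m *\<^sub>R v n \<in> K \<and> (\<forall>m'. x n - m' *\<^sub>R v n \<in> K \<longrightarrow> m' \<le> m)" for n
    using max_coeff[of "x n" "v n"] assms(4)[of n] v[of n] I_K zero_notin by (metis x_def)
  then obtain m where m: "\<And>n. m n > 0" "\<And>n. x n - m n *\<^sub>R v n \<in> K"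
    "\<And>n m'. x n - m' *\<^sub>R v n \<in> K \<Longrightarrow> m' \<le> m n"
    by metis
  \<comment> \<open>The product \<open>t n * m n = exp (- real n)\<close> tends to zero, as the
    facet opposite \<open>v n\<close> demands, but more slowly than the bound
    \<open>exp (- 2 * real n)\<close> in \<open>thick\<close>. One factor
    \<open>exp (- real n)\<close> is left for the other facets.\<close>
  define t where "t = (\<lambda>n. exp (- real n) / m n)"
  have tm: "t n * m n = exp (- real n)" and t: "t n > 0" for n
    using m(1)[of n] by (auto simp: t_def)
  have lim: "(\<lambda>n. 2 * exp (- real n)) \<longlonglongrightarrow> 2 * 0"
    by (intro tendsto_mult tendsto_const filterlim_compose[OF exp_at_bot]
        filterlim_compose[OF filterlim_uminus_at_bot_at_top] filterlim_real_sequentially)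
  \<comment> \<open>The facets will yield \<open>e \<le> exp (- real n)\<close> and
    \<open>e \<le> 2 * exp (- real n)\<close> respectively.\<close>
  have small: "\<forall>\<^sub>F n in sequentially. 2 * exp (- real n) < e" if "e > 0" for e :: real
    using order_tendstoD(2)[OF lim] that by simp
  define w where "w = (\<lambda>n i. case i of 0 \<Rightarrow> v n | Suc i \<Rightarrow> t n *\<^sub>R p n i)"
  have sum: "(\<Sum>i\<le>Suc k. w n i) = v n + t n *\<^sub>R x n" for n
    by (simp only: sum.atMost_Suc_shift) (simp add: w_def x_def scaleR_sum_right)
  have xI: "x n \<in> I" for n using assms(4) by (simp add: x_def)
  show ?thesis
  proof (rule rescaling[OF qh])
    show "w n i \<in> K" if "i \<le> Suc k" for n i
      using that v p t[of n] by (auto simp: w_def less_imp_le intro!: K_scale intro: I_K split: nat.split)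
    show "(\<Sum>i\<le>Suc k. w n i) \<in> I" for n
      unfolding sum using v xI t by (intro add scale)
    fix j and e :: real assume j: "j \<le> Suc k" and e: "e > 0"
    have "(\<Sum>i\<le>Suc k. w n i) - w n j - e *\<^sub>R (\<Sum>i\<le>Suc k. w n i) \<notin> I"
      if n: "2 * exp (- real n) < e" for n
    proof
      assume *: "(\<Sum>i\<le>Suc k. w n i) - w n j - e *\<^sub>R (\<Sum>i\<le>Suc k. w n i) \<in> I"
      show False
      proof (cases j)
        case 0
        with * have I: "((1 - e) * t n) *\<^sub>R x n - e *\<^sub>R v n \<in> I"
          unfolding sum by (simp add: w_def algebra_simps)
        then have "(1 - e) * t n * (f \<bullet> x n) - e * (f \<bullet> v n) > 0"
          using pos by (fastforce simp: inner_diff_right)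
        moreover have "e * (f \<bullet> v n) > 0" using pos[OF v] e by simp
        ultimately have "(1 - e) * (t n * (f \<bullet> x n)) > 0" by (simp add: mult.assoc)
        then have e1: "1 - e > 0" using mult_pos_pos[OF t pos[OF xI], of n n] zero_less_mult_pos2 by blast
        have "(1 / ((1 - e) * t n)) *\<^sub>R (((1 - e) * t n) *\<^sub>R x n - e *\<^sub>R v n) \<in> I"
          using I e1 t[of n] by (intro scale) auto
        then have "x n - (e / ((1 - e) * t n)) *\<^sub>R v n \<in> K"
          using e1 t[of n] I_K by (simp add: scaleR_diff_right)
        then have "e / ((1 - e) * t n) \<le> m n" by (rule m(3))
        then have "e \<le> (1 - e) * (t n * m n)" using e1 t[of n] by (simp add: field_simps)
        also have "\<dots> \<le> 1 * (t n * m n)" using e tm by (intro mult_right_mono) auto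
        finally show False using n tm[of n] exp_gt_zero[of "- real n"] by linarith
      next
        case (Suc i)
        then have i: "i \<le> k" using j by simp
        define q where "q = v n + t n *\<^sub>R (x n - p n i)"
        have "q - e *\<^sub>R (v n + t n *\<^sub>R x n) \<in> I"
          using * Suc unfolding sum by (simp add: w_def q_def algebra_simps)
        then have "q - e *\<^sub>R (v n + t n *\<^sub>R x n) + e *\<^sub>R v n \<in> I"
          using v e by (intro add scale) auto
        then have 1: "q - (e * t n) *\<^sub>R x n \<in> K" using I_K by (simp add: algebra_simps)
        \<comment> \<open>Division of \<open>x n - m n *\<^sub>R v n\<close> by
          \<open>t n * m n + 1\<close> shows that \<open>x n\<close> dominates \<open>b\<close>
          times \<open>v n + t n *\<^sub>R x n\<close>, and therefore \<open>b\<close> times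
          \<open>q\<close>.\<close>
        define b where "b = m n / (t n * m n + 1)"
        have den: "t n * m n + 1 > 0" using tm[of n] by (simp add: add_pos_pos)
        have b: "b > 0" using m(1)[of n] den by (simp add: b_def)
        have eq: "(1 / (t n * m n + 1)) *\<^sub>R (x n - m n *\<^sub>R v n) = x n - b *\<^sub>R (v n + t n *\<^sub>R x n)"
        proof -
          have "1 / (t n * m n + 1) = 1 - b * t n" using den by (simp add: b_def field_simps)
          moreover have "(1 / (t n * m n + 1)) * m n = b" by (simp add: b_def)
          ultimately show ?thesis
            by (simp add: scaleR_diff_right scaleR_add_right) (simp add: scaleR_diff_left)
        qed
        have "(1 / (t n * m n + 1)) *\<^sub>R (x n - m n *\<^sub>R v n) + (b * t n) *\<^sub>R p n i \<in> K"
          using den m(2) p[OF i] b t[of n] by (intro K_add K_scale) auto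
        then have 2: "x n - b *\<^sub>R q \<in> K" unfolding eq by (simp add: q_def algebra_simps)
        have "(e * t n) * b \<le> exp (- 2 * real n)"
          using thick[OF i t[of n], of "e * t n" b n] 1 2 e t[of n] b by (simp add: q_def x_def)
        then have "e * (t n * m n) \<le> exp (- 2 * real n) * (t n * m n + 1)"
          using den by (simp add: b_def field_simps)
        then have le: "e * exp (- real n) \<le> exp (- 2 * real n) * (exp (- real n) + 1)"
          unfolding tm .
        have "exp (- 2 * real n) = exp (- real n) * exp (- real n)" by (simp flip: exp_add)
        then have "exp (- real n) * e \<le> exp (- real n) * (exp (- real n) * (exp (- real n) + 1))"
          using le by (simp only: mult_ac)
        then have "e \<le> exp (- real n) * (exp (- real n) + 1)"
          by (simp only: mult_le_cancel_left_pos exp_gt_zero)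
        also have "\<dots> \<le> exp (- real n) * (1 + 1)" by (intro mult_left_mono add_right_mono) auto
        finally show False using n by simp
      qed
    qed
    then show "\<forall>\<^sub>F n in sequentially. (\<Sum>i\<le>Suc k. w n i) - w n j - e *\<^sub>R (\<Sum>i\<le>Suc k. w n i) \<notin> I"
      using small[OF e] by (auto elim!: eventually_mono)
  qed
qed

text \<open>The vectors \<open>p i\<close> have \<open>x\<close> on the facet opposite index 0,
  while their other facets lie in facet cones of \<open>u\<close> and so avoid \<open>I\<close>.
  Adding a small multiple of \<open>x\<close> to each \<open>p i\<close> produces vertices in
  \<open>I\<close> and keeps \<open>x\<close> on that facet. On the other facets, domination of
  \<open>x\<close> comes only from these small multiples.\<close>

lemma thick_of_simplicial:
  assumes s: "simplicial k u" and k: "k \<ge> 1" and e: "e > 0"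
  obtains V x where "\<And>i. i \<le> k \<Longrightarrow> V i \<in> I" "x \<in> I" "x \<in> conic V ({..k} - {0})"
    "\<And>j q a b. j \<le> k \<Longrightarrow> j \<noteq> 0 \<Longrightarrow> q \<in> conic V ({..k} - {j}) \<Longrightarrow> 0 < a \<Longrightarrow> 0 < b \<Longrightarrow>
       q - a *\<^sub>R x \<in> K \<Longrightarrow> x - b *\<^sub>R q \<in> K \<Longrightarrow> a * b \<le> e"
proof -
  have uK: "\<And>i. i \<le> k \<Longrightarrow> u i \<in> K" and uI: "(\<Sum>i\<le>k. u i) \<in> I"
    and fac: "\<And>j. j \<le> k \<Longrightarrow> conic u ({..k} - {j}) \<inter> I = {}"
    using s unfolding simplicial_iff_conic by auto
  define x where "x = (\<Sum>i\<le>k. u i)"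
  have xI: "x \<in> I" using uI by (simp add: x_def)
  have fx: "f \<bullet> x > 0" using pos[OF xI] .
  \<comment> \<open>The normalization makes the final bound \<open>t * (f \<bullet> x)\<close> equal
    to \<open>e\<close>.\<close>
  define t where "t = e / (f \<bullet> x)"
  have t: "t > 0" "t * (f \<bullet> x) = e" using fx e by (auto simp: t_def)
  \<comment> \<open>Distributing \<open>u 0\<close> evenly over the vertices of positive index makes
    their sum \<open>x\<close>; for \<open>j \<noteq> 0\<close>, the vector \<open>u j\<close>
    enters only \<open>p j\<close>.\<close>
  define p where "p = (\<lambda>i. if i = 0 then u 0 else (1 / real k) *\<^sub>R u 0 + u i)"
  define V where "V = (\<lambda>i. p i + (t * (f \<bullet> p i)) *\<^sub>R x)"
  have pK: "p i \<in> K" if "i \<le> k" for i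
    using uK that by (auto simp: p_def intro!: K_add K_scale)
  have fp: "f \<bullet> p i > 0" if "i \<le> k" for i
  proof -
    have "f \<bullet> u i > 0" using that uK closure_pos simplicial_nonzero[OF s] by blast
    moreover have "f \<bullet> u 0 \<ge> 0" using uK K_nonneg by simp
    ultimately show ?thesis by (auto simp: p_def inner_add_right add_nonneg_pos)
  qed
  have V: "V i \<in> I" if "i \<le> k" for i
    unfolding V_def using pK fp that t xI by (intro K_I_add scale) auto
  have "(\<Sum>i\<in>{..k} - {0}. p i) = (\<Sum>i\<in>{..k} - {0}. (1 / real k) *\<^sub>R u 0 + u i)"
    by (intro sum.cong) (auto simp: p_def)
  also have "\<dots> = u 0 + (\<Sum>i\<in>{..k} - {0}. u i)"
    using k by (simp add: sum.distrib sum_constant_scaleR)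
  also have "\<dots> = x" by (simp add: x_def sum_diff1)
  finally have sump: "(\<Sum>i\<in>{..k} - {0}. p i) = x" .
  have sumV: "(\<Sum>i\<in>J. c i *\<^sub>R V i) = (\<Sum>i\<in>J. c i *\<^sub>R p i) + (t * (f \<bullet> (\<Sum>i\<in>J. c i *\<^sub>R p i))) *\<^sub>R x" for c J
    by (simp add: V_def scaleR_add_right sum.distrib inner_sum_right sum_distrib_left
        scaleR_sum_left mult_ac)
  have "x \<in> conic V ({..k} - {0})"
  proof -
    have "(\<Sum>i\<in>{..k} - {0}. 1 *\<^sub>R V i) \<in> conic V ({..k} - {0})" by (rule conicI) simp
    then have "(1 + e) *\<^sub>R x \<in> conic V ({..k} - {0})"
      unfolding sumV by (simp add: sump t scaleR_add_left)
    from conic_scale[OF this, of "1 / (1 + e)"] show ?thesis using e by simp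
  qed
  moreover have "a * b \<le> e"
    if j: "j \<le> k" "j \<noteq> 0" and q: "q \<in> conic V ({..k} - {j})" and ab: "0 < a" "0 < b"
      and 1: "q - a *\<^sub>R x \<in> K" and 2: "x - b *\<^sub>R q \<in> K" for j q a b
  proof -
    obtain c where c: "\<forall>i\<in>{..k} - {j}. 0 \<le> c i" "q = (\<Sum>i\<in>{..k} - {j}. c i *\<^sub>R V i)"
      using q by (rule conicE)
    define r where "r = (\<Sum>i\<in>{..k} - {j}. c i *\<^sub>R p i)"
    have q_eq: "q = r + (t * (f \<bullet> r)) *\<^sub>R x" unfolding c(2) sumV r_def ..
    have "p l \<in> conic u ({..k} - {j})" if "l \<in> {..k} - {j}" for l
      using that j by (auto simp: p_def intro!: conic_add conic_scale conic_generator)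
    then have r: "r \<in> conic u ({..k} - {j})"
      unfolding r_def using c(1) by (intro conic_sum conic_scale) auto
    have rK: "r \<in> K" by (rule conic_K[OF _ r]) (use uK in auto)
    \<comment> \<open>If \<open>a\<close> exceeded the coefficient of \<open>x\<close> in
      \<open>q\<close>, the facet part \<open>r\<close> would lie in \<open>I\<close>.\<close>
    have "a \<le> t * (f \<bullet> r)"
    proof (rule ccontr)
      assume "\<not> ?thesis"
      then have "(q - a *\<^sub>R x) + (a - t * (f \<bullet> r)) *\<^sub>R x \<in> I"
        using 1 xI by (intro K_I_add scale) auto
      then have "r \<in> I" by (simp add: q_eq algebra_simps)
      then show False using r fac j by blast
    qed
    also have "\<dots> \<le> t * (f \<bullet> q)"
      using t K_nonneg[OF rK] fx by (intro mult_left_mono) (auto simp: q_eq inner_add_right)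
    finally have "a * b \<le> t * (f \<bullet> q) * b" using ab by simp
    also have "\<dots> = t * (b * (f \<bullet> q))" by simp
    also have "\<dots> \<le> t * (f \<bullet> x)"
      using K_nonneg[OF 2] t by (intro mult_left_mono) (auto simp: inner_diff_right)
    finally show ?thesis using t by simp
  qed
  ultimately show thesis using that[of V x] V xI by blast
qed

end

section \<open>The Hilbert metric on the cone\<close>

text \<open>On representatives the chart is division by \<open>f\<close>, which is continuous off
  the kernel. This carries compact subsets of the domain to compact subsets of the cone.\<close>

lemma continuous_on_chart: "continuous_on (chart_dom f) (chart f)"
  unfolding continuous_on_open_invariant
proof (intro allI impI)
  fix B :: "(real^'a) set" assume "open B"
  define A where "A = {p \<in> chart_dom f. chart f p \<in> B}"
  have "v \<noteq> 0 \<and> proj_pt v \<in> A \<longleftrightarrow> f \<bullet> v \<noteq> 0 \<and> (1 / (f \<bullet> v)) *\<^sub>R v \<in> B" for v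
  proof (cases "f \<bullet> v = 0")
    case True
    then show ?thesis using proj_pt_in_chart_dom[of v f] by (auto simp: A_def)
  next
    case False
    then have "v \<noteq> 0" by auto
    then show ?thesis using False by (simp add: A_def proj_pt_in_chart_dom chart_proj_pt)
  qed
  then have "{v. v \<noteq> 0 \<and> proj_pt v \<in> A} = {v. f \<bullet> v \<noteq> 0} \<inter> (\<lambda>v. (1 / (f \<bullet> v)) *\<^sub>R v) -` B"
    by auto
  moreover have op: "open {v. f \<bullet> v \<noteq> 0}"
    by (intro open_Collect_neq continuous_on_inner continuous_on_const continuous_on_id)
  have "open ({v. f \<bullet> v \<noteq> 0} \<inter> (\<lambda>v. (1 / (f \<bullet> v)) *\<^sub>R v) -` B)"
    by (rule continuous_open_preimage[OF _ op \<open>open B\<close>]) (intro continuous_intros, auto)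
  ultimately have "open A" by (simp add: open_proj_def)
  then show "\<exists>A. open A \<and> A \<inter> chart_dom f = chart f -` B \<inter> chart_dom f"
    by (intro exI[of _ A]) (auto simp: A_def)
qed

lemma proj_pt_in_proj_line:
  assumes "z \<noteq> 0" "u \<noteq> 0" "w \<noteq> 0"
  shows "proj_pt z \<in> proj_line (proj_pt u) (proj_pt w) \<longleftrightarrow> (\<exists>p q. z = p *\<^sub>R u + q *\<^sub>R w)"
proof -
  have "span (span {u} \<union> span {w}) = span {u, w}"
  proof (rule subset_antisym)
    show "span (span {u} \<union> span {w}) \<subseteq> span {u, w}"
      by (intro span_minimal Un_least span_mono subspace_span) auto
    show "span {u, w} \<subseteq> span (span {u} \<union> span {w})"
      by (intro span_mono) (auto intro: span_base)
  qed
  then have "proj_pt z \<in> proj_line (proj_pt u) (proj_pt w) \<longleftrightarrow> span {z} \<subseteq> span {u, w}"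
    using assms by (simp add: proj_line_def lin_span_def line_of_proj_pt)
  also have "\<dots> \<longleftrightarrow> z \<in> span {u, w}"
    using span_base[of z "{z}"] span_minimal[of "{z}" "span {u, w}"] subspace_span by blast
  also have "\<dots> \<longleftrightarrow> (\<exists>p. z - p *\<^sub>R u \<in> span {w})" by (rule span_breakdown_eq)
  also have "\<dots> \<longleftrightarrow> (\<exists>p q. z - p *\<^sub>R u = q *\<^sub>R w)" unfolding span_singleton by blast
  also have "\<dots> \<longleftrightarrow> (\<exists>p q. z = p *\<^sub>R u + q *\<^sub>R w)" by (simp add: diff_eq_eq add.commute)
  finally show ?thesis .
qed

section \<open>The open cone over a convex domain\<close>

locale convex_domain =
  fixes \<Omega> :: "'d::finite proj set" and f :: "real^'d"
  assumes chart: "convex_chart \<Omega> f" and domain_open: "open \<Omega>" and domain_nonempty: "\<Omega> \<noteq> {}"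

sublocale convex_domain \<subseteq> open_cone "lift f \<Omega>" f
proof -
  interpret pos_cone "lift f \<Omega>" f using chart domain_nonempty by (rule pos_cone_lift)
  have "lift f \<Omega> = {v. f \<bullet> v > 0} \<inter> {v. v \<noteq> 0 \<and> proj_pt v \<in> \<Omega>}" by (auto simp: mem_lift)
  moreover have "open ({v. f \<bullet> v > 0} \<inter> {v. v \<noteq> 0 \<and> proj_pt v \<in> \<Omega>})"
    using domain_open by (intro open_Int open_halfspace_gt) (simp add: open_proj_def)
  ultimately show "open_cone (lift f \<Omega>) f" by unfold_locales simp
qed

context convex_domain
begin

abbreviation I where "I \<equiv> lift f \<Omega>"

lemma closure_dom: "closure \<Omega> \<subseteq> chart_dom f" using chart by (simp add: convex_chart_def)

lemmas K_iff = closure_lift_iff[OF chart]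

lemma obtain_K: assumes "p \<in> closure \<Omega>" obtains v where "v \<in> K" "v \<noteq> 0" "p = proj_pt v"
proof -
  obtain v where v: "f \<bullet> v > 0" "p = proj_pt v" using assms closure_dom by (blast elim: proj_cases_pos)
  then have nz: "v \<noteq> 0" by auto
  have "v \<in> K" using K_iff[OF nz] v assms by simp
  then show thesis using nz v(2) by (rule that)
qed

lemma I_iff: "v \<in> K \<Longrightarrow> v \<noteq> 0 \<Longrightarrow> v \<in> I \<longleftrightarrow> proj_pt v \<in> \<Omega>"
  using closure_pos[of v] by (simp add: mem_lift)

lemma obtain_I: assumes "p \<in> \<Omega>" obtains v where "v \<in> I" "p = proj_pt v"
proof -
  have "p \<in> closure \<Omega>" using assms closure_subset by blast
  then obtain v where "v \<in> K" "v \<noteq> 0" "p = proj_pt v" by (rule obtain_K)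
  then show thesis using that[of v] assms I_iff[of v] by simp
qed

lemma I_nonzero: "v \<in> I \<Longrightarrow> v \<noteq> 0" using zero_notin by auto

lemma I_in_domain: "v \<in> I \<Longrightarrow> proj_pt v \<in> \<Omega>" by (simp add: mem_lift)

lemma proj_pt_eq_K:
  assumes "u \<in> K" "w \<in> K" "u \<noteq> 0" "w \<noteq> 0" "proj_pt u = proj_pt w"
  obtains c where "c > 0" "u = c *\<^sub>R w"
proof -
  obtain c where c: "c \<noteq> 0" "u = c *\<^sub>R w" using assms proj_pt_eqD by metis
  have "c * (f \<bullet> w) > 0" "f \<bullet> w > 0" using closure_pos[OF assms(1,3)] closure_pos[OF assms(2,4)] c by auto
  then have "c > 0" by (rule zero_less_mult_pos2)
  with c that show thesis by blast
qed

text \<open>In the slice where \<open>f\<close> is 1, the line through \<open>u\<close> and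
  \<open>w\<close> leaves \<open>K\<close> at the normalized vectors
  \<open>u - l *\<^sub>R w\<close> and \<open>w - m *\<^sub>R u\<close>. Each end divides distances
  in the ratio \<open>l\<close> or \<open>m\<close>, so the cross-ratio is
  \<open>1 / (l * m)\<close>. \<open>val\<close> computes it for arbitrary chord ends; the rest
  shows that chord ends exist, as the definite description requires.\<close>

lemma hilbert_dist_normalized:
  assumes f: "f = chart_of \<Omega>"
    and uw: "u \<in> I" "w \<in> I" "f \<bullet> u = 1" "f \<bullet> w = 1" "u \<noteq> w"
    and l: "l > 0" "u - l *\<^sub>R w \<in> K" "\<And>a. u - a *\<^sub>R w \<in> K \<Longrightarrow> a \<le> l"
    and m: "m > 0" "w - m *\<^sub>R u \<in> K" "\<And>a. w - a *\<^sub>R u \<in> K \<Longrightarrow> a \<le> m"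
  shows "hilbert_dist \<Omega> (proj_pt u) (proj_pt w) = - ln (l * m) / 2"
proof -
  have ch: "chart f (proj_pt v) = v" if "f \<bullet> v = 1" for v using that by (simp add: chart_proj_pt)
  have ne: "proj_pt u \<noteq> proj_pt w" using uw ch by metis
  have val: "r = - ln (l * m) / 2"
    if ce: "chord_ends \<Omega> (proj_pt u) (proj_pt w) a b"
      and r: "r = 1/2 * ln ((norm (chart f (proj_pt w) - chart f a) * norm (chart f (proj_pt u) - chart f b)) /
          (norm (chart f (proj_pt u) - chart f a) * norm (chart f (proj_pt w) - chart f b)))"
    for r a b
  proof -
    have end_pt: "chart f p \<in> K" "chart f p \<notin> I" if "p \<in> pboundary \<Omega>" for p
    proof -
      have p: "p \<in> closure \<Omega>" "p \<notin> \<Omega>" using that by (auto simp: pboundary_def)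
      obtain v where v: "v \<in> K" "v \<noteq> 0" "p = proj_pt v" using p(1) by (rule obtain_K)
      have fv: "f \<bullet> v > 0" using closure_pos v by blast
      then have c: "chart f p = (1 / (f \<bullet> v)) *\<^sub>R v" using v by (simp add: chart_proj_pt)
      show "chart f p \<in> K" unfolding c using v fv by (intro K_scale) auto
      show "chart f p \<notin> I" unfolding c using p v fv by (simp add: mem_lift proj_pt_scale)
    qed
    define A where "A = chart f a"
    define B where "B = chart f b"
    have A: "A \<in> K" "A \<notin> I" "u \<in> open_segment A w" and B: "B \<in> K" "B \<notin> I" "w \<in> open_segment u B"
      using ce end_pt uw ch unfolding chord_ends_def Let_def f[symmetric] A_def B_def by auto
    \<comment> \<open>A chord endpoint lies on the boundary, so its parameter is the maximal coefficient.\<close>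
    have key: "s = l'" if s: "0 < s" "s < 1" and E: "E \<in> K" "E \<notin> I" and x: "x \<in> I" "x - l' *\<^sub>R y \<in> K"
      "\<And>a. x - a *\<^sub>R y \<in> K \<Longrightarrow> a \<le> l'" "l' > 0" and eq: "x - s *\<^sub>R y = (1 - s) *\<^sub>R E" for s l' :: real and E x y
    proof (rule antisym)
      show "s \<le> l'" using x(3)[of s] eq E(1) s by (simp add: K_scale)
      show "l' \<le> s"
      proof (rule ccontr)
        assume less: "\<not> l' \<le> s"
        have "(s / l') *\<^sub>R (x - l' *\<^sub>R y) + (1 - s / l') *\<^sub>R x \<in> I"
          using s x less by (intro K_I_add K_scale scale) auto
        also have "(s / l') *\<^sub>R (x - l' *\<^sub>R y) + (1 - s / l') *\<^sub>R x = (1 - s) *\<^sub>R E"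
          using x(4) unfolding eq[symmetric] by (simp add: algebra_simps)
        finally have I: "(1 - s) *\<^sub>R E \<in> I" .
        show False using scale[OF I, of "1 / (1 - s)"] E s by simp
      qed
    qed
    obtain s where s: "0 < s" "s < 1" "u = (1 - s) *\<^sub>R A + s *\<^sub>R w" and Aw: "A \<noteq> w"
      using A(3) unfolding in_segment by auto
    have sl: "s = l"
    proof (rule key[OF s(1,2) A(1,2) uw(1) l(2,3,1)])
      show "u - s *\<^sub>R w = (1 - s) *\<^sub>R A" by (subst s(3)) simp
    qed
    obtain t where t: "0 < t" "t < 1" "w = (1 - t) *\<^sub>R u + t *\<^sub>R B" and Bu: "u \<noteq> B"
      using B(3) unfolding in_segment by auto
    have tm: "1 - t = m"
    proof (rule key[OF _ _ B(1,2) uw(2) m(2,3,1)])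
      show "w - (1 - t) *\<^sub>R u = (1 - (1 - t)) *\<^sub>R B" using t(3) by (simp add: algebra_simps)
    qed (use t in auto)
    have "u - A = s *\<^sub>R (w - A)" by (subst s(3)) (simp add: algebra_simps)
    moreover have "w - B = (1 - t) *\<^sub>R (u - B)" by (subst t(3)) (simp add: algebra_simps)
    ultimately have "u - A = l *\<^sub>R (w - A)" "w - B = m *\<^sub>R (u - B)" by (simp_all only: sl tm)
    then have "norm (u - A) = l * norm (w - A)" "norm (w - B) = m * norm (u - B)"
      using l m by auto
    moreover have "norm (w - A) > 0" "norm (u - B) > 0" using Aw Bu by auto
    ultimately have "norm (w - A) * norm (u - B) / (norm (u - A) * norm (w - B)) = 1 / (l * m)"
      by simp
    then have "r = 1 / 2 * ln (1 / (l * m))"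
      using r uw by (simp add: ch A_def B_def)
    then show ?thesis using l m by (simp add: ln_div)
  qed
  \<comment> \<open>Applying \<open>f\<close> gives \<open>a \<le> 1\<close>, and equality would
    force \<open>x = y\<close>.\<close>
  have less1: "a < 1" if "x \<noteq> y" "x - a *\<^sub>R y \<in> K" "f \<bullet> x = 1" "f \<bullet> y = 1" for a x y
  proof (cases "x - a *\<^sub>R y = 0")
    case True
    then have "1 - a * 1 = 0" using that by (metis inner_diff_right inner_scaleR_right inner_zero_right)
    then show ?thesis using True that by simp
  next
    case False
    then show ?thesis using closure_pos[OF that(2)] that by (simp add: inner_diff_right)
  qed
  have l1: "l < 1" and m1: "m < 1" using less1 uw l(2) m(2) by metis+
  define A where "A = (1 / (1 - l)) *\<^sub>R (u - l *\<^sub>R w)"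
  define B where "B = (1 / (1 - m)) *\<^sub>R (w - m *\<^sub>R u)"
  have fA: "f \<bullet> A = 1" "f \<bullet> B = 1" using uw l1 m1 by (simp_all add: A_def B_def inner_diff_right)
  have AK: "A \<in> K" "B \<in> K" unfolding A_def B_def using l m l1 m1 by (auto intro!: K_scale)
  \<comment> \<open>At an interior point the coefficient \<open>a\<close> could still be
    enlarged.\<close>
  have bd: "(1 / (1 - a)) *\<^sub>R (x - a *\<^sub>R y) \<notin> I" if "a < 1" "\<And>b. x - b *\<^sub>R y \<in> K \<Longrightarrow> b \<le> a" for a :: real and x y
  proof
    assume "(1 / (1 - a)) *\<^sub>R (x - a *\<^sub>R y) \<in> I"
    from scale[OF this, of "1 - a"] have "x - a *\<^sub>R y \<in> I" using that by simp
    then obtain e where "e > 0" "x - a *\<^sub>R y - e *\<^sub>R y \<in> I" by (rule I_minus)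
    then have "x - (a + e) *\<^sub>R y \<in> K" using I_K by (simp add: algebra_simps)
    from that(2)[OF this] \<open>e > 0\<close> show False by simp
  qed
  have AI: "A \<notin> I" "B \<notin> I" unfolding A_def B_def using bd l1 m1 l(3) m(3) by blast+
  have nz: "A \<noteq> 0" "B \<noteq> 0" using fA by auto
  have pb: "proj_pt A \<in> pboundary \<Omega>" "proj_pt B \<in> pboundary \<Omega>"
    using K_iff nz AK AI I_iff by (auto simp: pboundary_def)
  have segA: "u \<in> open_segment A w"
  proof -
    have "u = (1 - l) *\<^sub>R A + l *\<^sub>R w" using l1 by (simp add: A_def)
    moreover from this have "A \<noteq> w" using uw(5) by (auto simp: algebra_simps)
    ultimately show ?thesis unfolding in_segment using l l1 by auto
  qed
  have segB: "w \<in> open_segment u B"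
  proof -
    have "w = (1 - (1 - m)) *\<^sub>R u + (1 - m) *\<^sub>R B" using m1 by (simp add: B_def)
    moreover from this have "u \<noteq> B" using uw(5) by (auto simp: algebra_simps)
    ultimately show ?thesis unfolding in_segment using m m1 by (intro conjI exI[of _ "1 - m"]) auto
  qed
  have line: "chart f ` (proj_line (proj_pt u) (proj_pt w) \<inter> closure \<Omega>) = closed_segment A B"
  proof (intro subset_antisym subsetI)
    fix c assume "c \<in> chart f ` (proj_line (proj_pt u) (proj_pt w) \<inter> closure \<Omega>)"
    then obtain z where z: "z \<in> proj_line (proj_pt u) (proj_pt w)" "z \<in> closure \<Omega>" "c = chart f z" by auto
    obtain v where v: "v \<in> K" "v \<noteq> 0" "z = proj_pt v" using z(2) by (rule obtain_K)
    have fv: "f \<bullet> v > 0" using closure_pos v by blast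
    have c: "c = (1 / (f \<bullet> v)) *\<^sub>R v" using v z fv by (simp add: chart_proj_pt)
    have cK: "c \<in> K" unfolding c using v fv by (intro K_scale) auto
    have fc: "f \<bullet> c = 1" using fv by (simp add: c)
    obtain p' q' where "v = p' *\<^sub>R u + q' *\<^sub>R w"
      using z(1) proj_pt_in_proj_line[of v u w] v I_nonzero uw by blast
    then have "c = (p' / (f \<bullet> v)) *\<^sub>R u + (q' / (f \<bullet> v)) *\<^sub>R w" by (simp add: c scaleR_add_right)
    then obtain p q where pq: "c = p *\<^sub>R u + q *\<^sub>R w" by blast
    have "p + q = 1" using fc uw by (simp add: pq inner_add_right)
    then have "q = 1 - p" by simp
    then have c_eq: "c = p *\<^sub>R u + (1 - p) *\<^sub>R w" using pq by simp
    \<comment> \<open>Dividing \<open>c\<close> by a positive \<open>u\<close>-coordinate turns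
      membership in \<open>K\<close> into a bound by the maximal coefficient \<open>l\<close>;
      \<open>p2\<close> does the same at the other end with \<open>m\<close>.\<close>
    have p1: "p * (1 - l) \<le> 1"
    proof (cases "p > 0")
      case True
      have "(1 / p) *\<^sub>R c \<in> K" using cK True by (intro K_scale) auto
      also have "(1 / p) *\<^sub>R c = u - ((p - 1) / p) *\<^sub>R w"
        using True by (simp add: c_eq scaleR_add_right diff_divide_distrib algebra_simps)
      finally have "(p - 1) / p \<le> l" by (rule l(3))
      then show ?thesis using True by (simp add: field_simps)
    next
      case False
      then have "p * (1 - l) \<le> 0" using l1 by (intro mult_nonpos_nonneg) auto
      then show ?thesis by simp
    qed
    have p2: "- p * (1 - m) \<le> m"
    proof (cases "1 - p > 0")
      case True
      have "(1 / (1 - p)) *\<^sub>R c \<in> K" using cK True by (intro K_scale) auto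
      also have "(1 / (1 - p)) *\<^sub>R c = w - (- p / (1 - p)) *\<^sub>R u"
        using True by (simp add: c_eq scaleR_add_right)
      finally have "- p / (1 - p) \<le> m" by (rule m(3))
      then show ?thesis using True by (simp add: field_simps)
    next
      case False
      then have "- p * (1 - m) \<le> 0" using m1 by (intro mult_nonpos_nonneg) auto
      then show ?thesis using m by simp
    qed
    \<comment> \<open>\<open>A\<close> and \<open>B\<close> have \<open>u\<close>-coordinates \<open>1 / (1 - l)\<close> and \<open>- m / (1 - m)\<close>.\<close>
    define r where "r = (1 / (1 - l) - p) / (1 / (1 - l) + m / (1 - m))"
    have den: "1 / (1 - l) + m / (1 - m) > 0" using l1 m1 m by (simp add: add_pos_pos)
    have "p \<le> 1 / (1 - l)" using p1 l1 by (simp add: pos_le_divide_eq)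
    moreover have "- p \<le> m / (1 - m)" using p2 m1 by (simp only: pos_le_divide_eq diff_gt_0_iff_gt)
    ultimately have r: "0 \<le> r" "r \<le> 1"
      unfolding r_def using den by (auto simp: divide_le_eq_1_pos)
    have coord: "(1 - r) * (1 / (1 - l)) + r * (- m / (1 - m)) = p"
    proof -
      have "r * (1 / (1 - l) + m / (1 - m)) = 1 / (1 - l) - p" using den by (simp add: r_def)
      moreover have "(1 - r) * a + r * (- b) = a - r * (a + b)" for a b :: real
        by (simp add: algebra_simps)
      ultimately show ?thesis by (metis minus_divide_left diff_diff_eq2 add_diff_cancel_left')
    qed
    have "A = w + (1 / (1 - l)) *\<^sub>R (u - w)"
    proof -
      have "u - l *\<^sub>R w = (1 - l) *\<^sub>R w + (u - w)" by (simp add: algebra_simps)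
      then show ?thesis using l1 unfolding A_def by (simp only: scaleR_add_right) simp
    qed
    moreover have "B = w + (- m / (1 - m)) *\<^sub>R (u - w)"
    proof -
      have "w - m *\<^sub>R u = (1 - m) *\<^sub>R w + (- m) *\<^sub>R (u - w)" by (simp add: algebra_simps)
      then show ?thesis using m1 unfolding B_def by (simp only: scaleR_add_right) simp
    qed
    ultimately have "(1 - r) *\<^sub>R A + r *\<^sub>R B
        = w + ((1 - r) * (1 / (1 - l)) + r * (- m / (1 - m))) *\<^sub>R (u - w)"
      by (simp only: scaleR_add_right scaleR_add_left scaleR_scaleR) (simp add: algebra_simps)
    also have "\<dots> = c" unfolding coord by (simp add: c_eq algebra_simps)
    finally show "c \<in> closed_segment A B" using r unfolding in_segment by metis
  next
    fix c assume "c \<in> closed_segment A B"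
    then obtain r where r: "0 \<le> r" "r \<le> 1" "c = (1 - r) *\<^sub>R A + r *\<^sub>R B" unfolding in_segment by blast
    have cK: "c \<in> K" unfolding r(3) using r AK by (intro K_add K_scale) auto
    have fc: "f \<bullet> c = 1" using fA by (simp add: r(3) inner_add_right)
    then have "c \<noteq> 0" by auto
    have "c = ((1 - r) * (1 / (1 - l)) - r * (1 / (1 - m)) * m) *\<^sub>R u
        + (r * (1 / (1 - m)) - (1 - r) * (1 / (1 - l)) * l) *\<^sub>R w"
      unfolding r(3) A_def B_def
      by (simp only: scaleR_diff_left scaleR_diff_right scaleR_scaleR) simp
    then have "proj_pt c \<in> proj_line (proj_pt u) (proj_pt w)"
      using proj_pt_in_proj_line \<open>c \<noteq> 0\<close> I_nonzero uw by blast
    moreover have "proj_pt c \<in> closure \<Omega>" using K_iff \<open>c \<noteq> 0\<close> cK by blast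
    ultimately show "c \<in> chart f ` (proj_line (proj_pt u) (proj_pt w) \<inter> closure \<Omega>)"
      using ch[OF fc] by (intro image_eqI[of _ _ "proj_pt c"]) auto
  qed
  have ce: "chord_ends \<Omega> (proj_pt u) (proj_pt w) (proj_pt A) (proj_pt B)"
    unfolding chord_ends_def Let_def f[symmetric] using pb line segA segB fA uw by (simp add: ch)
  show ?thesis
    unfolding hilbert_dist_def Let_def f[symmetric] if_not_P[OF ne]
  proof (rule the_equality)
    show "\<exists>a b. chord_ends \<Omega> (proj_pt u) (proj_pt w) a b \<and>
      - ln (l * m) / 2 = 1/2 * ln ((norm (chart f (proj_pt w) - chart f a) * norm (chart f (proj_pt u) - chart f b)) /
          (norm (chart f (proj_pt u) - chart f a) * norm (chart f (proj_pt w) - chart f b)))"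
      using ce val[OF ce refl, symmetric] by blast
  qed (use val in blast)
qed

text \<open>Normalizing the vectors multiplies one maximal coefficient by \<open>t / s\<close> and
  the other by \<open>s / t\<close>, which leaves the product unchanged.\<close>

lemma hilbert_dist_max:
  assumes f: "f = chart_of \<Omega>"
    and uw: "u \<in> I" "w \<in> I" "proj_pt u \<noteq> proj_pt w"
    and l: "l > 0" "u - l *\<^sub>R w \<in> K" "\<And>a. u - a *\<^sub>R w \<in> K \<Longrightarrow> a \<le> l"
    and m: "m > 0" "w - m *\<^sub>R u \<in> K" "\<And>a. w - a *\<^sub>R u \<in> K \<Longrightarrow> a \<le> m"
  shows "hilbert_dist \<Omega> (proj_pt u) (proj_pt w) = - ln (l * m) / 2"
proof -
  define s where "s = f \<bullet> u"
  define t where "t = f \<bullet> w"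
  have st: "s > 0" "t > 0" using pos uw by (auto simp: s_def t_def)
  have conv: "(1 / s) *\<^sub>R x - a *\<^sub>R ((1 / t) *\<^sub>R y) \<in> K \<longleftrightarrow> x - (a * s / t) *\<^sub>R y \<in> K"
    if st: "s > 0" "t > 0" for s t a :: real and x y
  proof -
    have "x - (a * s / t) *\<^sub>R y = s *\<^sub>R ((1 / s) *\<^sub>R x - a *\<^sub>R ((1 / t) *\<^sub>R y))"
      "(1 / s) *\<^sub>R x - a *\<^sub>R ((1 / t) *\<^sub>R y) = (1 / s) *\<^sub>R (x - (a * s / t) *\<^sub>R y)"
      using st by (simp_all add: scaleR_diff_right)
    then show ?thesis using K_scale st by (metis less_imp_le divide_pos_pos zero_less_one)
  qed
  have "hilbert_dist \<Omega> (proj_pt ((1 / s) *\<^sub>R u)) (proj_pt ((1 / t) *\<^sub>R w))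
      = - ln ((l * t / s) * (m * s / t)) / 2"
  proof (rule hilbert_dist_normalized[OF f])
    show "(1 / s) *\<^sub>R u \<in> I" "(1 / t) *\<^sub>R w \<in> I" using uw st by (auto intro: scale)
    show "f \<bullet> (1 / s) *\<^sub>R u = 1" "f \<bullet> (1 / t) *\<^sub>R w = 1" using st by (auto simp: s_def t_def)
    show "(1 / s) *\<^sub>R u \<noteq> (1 / t) *\<^sub>R w"
      using uw(3) proj_pt_scale[of "1 / s" u] proj_pt_scale[of "1 / t" w] st by fastforce
    show "0 < l * t / s" "0 < m * s / t" using l m st by auto
    show "(1 / s) *\<^sub>R u - (l * t / s) *\<^sub>R (1 / t) *\<^sub>R w \<in> K" unfolding conv[OF st] using l st by simp
    show "(1 / t) *\<^sub>R w - (m * s / t) *\<^sub>R (1 / s) *\<^sub>R u \<in> K" unfolding conv[OF st(2,1)] using m st by simp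
    show "a \<le> l * t / s" if "(1 / s) *\<^sub>R u - a *\<^sub>R (1 / t) *\<^sub>R w \<in> K" for a
      using l(3)[OF that[unfolded conv[OF st]]] st by (simp add: field_simps)
    show "a \<le> m * s / t" if "(1 / t) *\<^sub>R w - a *\<^sub>R (1 / s) *\<^sub>R u \<in> K" for a
      using m(3)[OF that[unfolded conv[OF st(2,1)]]] st by (simp add: field_simps)
  qed
  moreover have "(l * t / s) * (m * s / t) = l * m" using st by simp
  ultimately show ?thesis using st by (simp add: proj_pt_scale)
qed

text \<open>\<open>u\<close> dominates \<open>a\<close> times \<open>w\<close>, hence
  \<open>a * b\<close> times itself.\<close>

lemma coeff_mult_le_1:
  assumes "u \<in> I" "u - a *\<^sub>R w \<in> K" "w - b *\<^sub>R u \<in> K" "0 \<le> a"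
  shows "a * b \<le> 1"
proof -
  have "(u - a *\<^sub>R w) + a *\<^sub>R (w - b *\<^sub>R u) \<in> K" using assms by (intro K_add K_scale)
  then have "(1 - a * b) *\<^sub>R u \<in> K" by (simp add: algebra_simps)
  from K_nonneg[OF this] show ?thesis using pos[OF assms(1)] by (simp add: zero_le_mult_iff)
qed

text \<open>Admissible coefficients are at most the maximal ones. For equal points the distance is
  0, and the bound reduces to \<open>a * b \<le> 1\<close>.\<close>

lemma hilbert_dist_le:
  assumes f: "f = chart_of \<Omega>" and uw: "u \<in> I" "w \<in> I"
    and ab: "0 < a" "0 < b" "u - a *\<^sub>R w \<in> K" "w - b *\<^sub>R u \<in> K"
  shows "hilbert_dist \<Omega> (proj_pt u) (proj_pt w) \<le> - ln (a * b) / 2"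
proof (cases "proj_pt u = proj_pt w")
  case True
  have "a * b \<le> 1" using coeff_mult_le_1[OF uw(1) ab(3,4)] ab by simp
  then show ?thesis using True ab by (simp add: hilbert_dist_def)
next
  case False
  obtain l where l: "l > 0" "u - l *\<^sub>R w \<in> K" "\<And>a. u - a *\<^sub>R w \<in> K \<Longrightarrow> a \<le> l"
    using max_coeff[OF uw(1) I_K[OF uw(2)] I_nonzero[OF uw(2)]] by blast
  obtain m where m: "m > 0" "w - m *\<^sub>R u \<in> K" "\<And>a. w - a *\<^sub>R u \<in> K \<Longrightarrow> a \<le> m"
    using max_coeff[OF uw(2) I_K[OF uw(1)] I_nonzero[OF uw(1)]] by blast
  have "a * b \<le> l * m" using l m ab by (intro mult_mono) auto
  then have "ln (a * b) \<le> ln (l * m)" using ab l m by simp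
  then show ?thesis using hilbert_dist_max[OF f uw False l m] by simp
qed

lemma hilbert_dist_attained:
  assumes f: "f = chart_of \<Omega>" and uw: "u \<in> I" "w \<in> I"
  obtains a b where "0 < a" "0 < b" "u - a *\<^sub>R w \<in> K" "w - b *\<^sub>R u \<in> K"
    "hilbert_dist \<Omega> (proj_pt u) (proj_pt w) = - ln (a * b) / 2"
proof (cases "proj_pt u = proj_pt w")
  case True
  obtain c where c: "c > 0" "u = c *\<^sub>R w"
    using proj_pt_eq_K[OF I_K[OF uw(1)] I_K[OF uw(2)] I_nonzero[OF uw(1)] I_nonzero[OF uw(2)] True] .
  then show thesis using that[of c "1 / c"] True zero_K by (simp add: hilbert_dist_def)
next
  case False
  obtain l where l: "l > 0" "u - l *\<^sub>R w \<in> K" "\<And>a. u - a *\<^sub>R w \<in> K \<Longrightarrow> a \<le> l"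
    using max_coeff[OF uw(1) I_K[OF uw(2)] I_nonzero[OF uw(2)]] by blast
  obtain m where m: "m > 0" "w - m *\<^sub>R u \<in> K" "\<And>a. w - a *\<^sub>R u \<in> K \<Longrightarrow> a \<le> m"
    using max_coeff[OF uw(2) I_K[OF uw(1)] I_nonzero[OF uw(1)]] by blast
  show thesis using that[OF l(1) m(1) l(2) m(2)] hilbert_dist_max[OF f uw False l m] by blast
qed

lemma hilbert_dist_nonneg:
  assumes "f = chart_of \<Omega>" "u \<in> I" "w \<in> I"
  shows "0 \<le> hilbert_dist \<Omega> (proj_pt u) (proj_pt w)"
proof -
  obtain a b where ab: "0 < a" "0 < b" "u - a *\<^sub>R w \<in> K" "w - b *\<^sub>R u \<in> K"
    "hilbert_dist \<Omega> (proj_pt u) (proj_pt w) = - ln (a * b) / 2"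
    using assms by (rule hilbert_dist_attained)
  then show ?thesis using coeff_mult_le_1[OF assms(2) ab(3,4)] by simp
qed

end

section \<open>Faces and automorphisms\<close>

context convex_domain
begin

text \<open>Mutual domination makes \<open>x - e *\<^sub>R w\<close> and
  \<open>w - e *\<^sub>R x\<close> the ends of a segment containing both points. Conversely, a
  segment in the closure lifts to the positive combinations of two vectors of \<open>K\<close>, any
  two of which dominate multiples of each other.\<close>

lemma face_at_iff:
  assumes x: "x \<in> K" "x \<noteq> 0" and w: "w \<in> K" "w \<noteq> 0"
  shows "proj_pt w \<in> face_at \<Omega> (proj_pt x) \<longleftrightarrow> face_eq x w"
proof
  assume "face_eq x w"
  then obtain d where d: "d > 0" "x - d *\<^sub>R w \<in> K" "w - d *\<^sub>R x \<in> K" unfolding face_eq_def by blast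
  have wcl: "proj_pt w \<in> closure \<Omega>" using K_iff w by blast
  show "proj_pt w \<in> face_at \<Omega> (proj_pt x)"
  proof (cases "proj_pt x = proj_pt w")
    case False
    \<comment> \<open>With \<open>e < 1\<close> the factor \<open>1 - e * e\<close> is positive, so
      \<open>x\<close> and \<open>w\<close> are recovered as positive combinations of
      \<open>a\<close> and \<open>b\<close>.\<close>
    define e where "e = min d (1 / 2)"
    have e: "0 < e" "e < 1" "e \<le> d" using d by (auto simp: e_def)
    define a where "a = x - e *\<^sub>R w"
    define b where "b = w - e *\<^sub>R x"
    have "(x - d *\<^sub>R w) + (d - e) *\<^sub>R w \<in> K" "(w - d *\<^sub>R x) + (d - e) *\<^sub>R x \<in> K"
      using d e x w by (intro K_add K_scale; simp)+
    then have ab: "a \<in> K" "b \<in> K" by (simp_all add: a_def b_def algebra_simps)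
    have nonprop: "x \<noteq> c *\<^sub>R w" if "c \<noteq> 0" for c using False proj_pt_scale[OF that, of w] by metis
    have e2: "e * e < 1" using mult_strict_mono[of e 1 e 1] e by simp
    have xe: "a + e *\<^sub>R b = (1 - e * e) *\<^sub>R x" and we: "e *\<^sub>R a + b = (1 - e * e) *\<^sub>R w"
      by (simp_all add: a_def b_def algebra_simps)
    have "a \<noteq> 0" using nonprop[of e] e by (auto simp: a_def)
    moreover have "b \<noteq> 0"
    proof
      assume "b = 0"
      then have "x = (1 / e) *\<^sub>R w" using e by (simp add: b_def)
      then show False using nonprop[of "1 / e"] e by simp
    qed
    moreover have "proj_pt a \<noteq> proj_pt b"
    proof
      assume "proj_pt a = proj_pt b"
      then obtain c where c: "c > 0" "a = c *\<^sub>R b"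
        using proj_pt_eq_K[OF ab calculation] by metis
      have "(1 - e * e) *\<^sub>R x = (c + e) *\<^sub>R b" "(1 - e * e) *\<^sub>R w = (e * c + 1) *\<^sub>R b"
        unfolding xe[symmetric] we[symmetric] c(2) by (simp_all add: algebra_simps)
      moreover have "c + e \<noteq> 0" "e * c + 1 \<noteq> 0"
        using c(1) e by (auto simp: add_pos_pos less_imp_neq[symmetric])
      ultimately show False
        using False e2 proj_pt_scale[of "1 - e * e" x] proj_pt_scale[of "1 - e * e" w]
          proj_pt_scale[of "c + e" b] proj_pt_scale[of "e * c + 1" b] by simp
    qed
    moreover define s where "s = {proj_pt (\<alpha> *\<^sub>R a + \<beta> *\<^sub>R b) |\<alpha> \<beta>. \<alpha> > 0 \<and> \<beta> > 0}"
    ultimately have "open_proj_segment s" unfolding open_proj_segment_def by blast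
    moreover have "s \<subseteq> closure \<Omega>"
    proof -
      have "proj_pt (\<alpha> *\<^sub>R a + \<beta> *\<^sub>R b) \<in> closure \<Omega>" if "\<alpha> > 0" "\<beta> > 0" for \<alpha> \<beta>
      proof -
        have mem: "\<alpha> *\<^sub>R a + \<beta> *\<^sub>R b \<in> K" using that ab by (intro K_add K_scale) auto
        have "f \<bullet> a > 0" "f \<bullet> b > 0" using closure_pos ab \<open>a \<noteq> 0\<close> \<open>b \<noteq> 0\<close> by blast+
        then have "f \<bullet> (\<alpha> *\<^sub>R a + \<beta> *\<^sub>R b) > 0" using that by (simp add: inner_add_right add_pos_pos)
        then have "\<alpha> *\<^sub>R a + \<beta> *\<^sub>R b \<noteq> 0" by auto
        then show ?thesis using K_iff mem by blast
      qed
      then show ?thesis by (auto simp: s_def)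
    qed
    moreover have "proj_pt x \<in> s"
    proof -
      have "proj_pt x = proj_pt (1 *\<^sub>R a + e *\<^sub>R b)" using e2 by (simp add: xe proj_pt_scale)
      then show ?thesis unfolding s_def using e(1) zero_less_one by blast
    qed
    moreover have "proj_pt w \<in> s"
    proof -
      have "proj_pt w = proj_pt (e *\<^sub>R a + 1 *\<^sub>R b)" using e2 by (simp add: we proj_pt_scale)
      then show ?thesis unfolding s_def using e(1) zero_less_one by blast
    qed
    ultimately show ?thesis using wcl unfolding face_at_def by blast
  qed (simp add: face_at_def)
next
  assume "proj_pt w \<in> face_at \<Omega> (proj_pt x)"
  then consider "proj_pt w = proj_pt x"
    | s where "open_proj_segment s" "s \<subseteq> closure \<Omega>" "proj_pt x \<in> s" "proj_pt w \<in> s"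
    unfolding face_at_def by blast
  then show "face_eq x w"
  proof cases
    case 1
    then obtain c where "c > 0" "w = c *\<^sub>R x" using proj_pt_eq_K w x by metis
    then show ?thesis using face_eq_sym face_eq_scale x by blast
  next
    case 2
    obtain a' b' where ab': "a' \<noteq> 0" "b' \<noteq> 0" "proj_pt a' \<noteq> proj_pt b'"
      and s': "s = {proj_pt (\<alpha> *\<^sub>R a' + \<beta> *\<^sub>R b') |\<alpha> \<beta>. \<alpha> > 0 \<and> \<beta> > 0}"
      using 2(1) unfolding open_proj_segment_def by blast
    have nz': "\<alpha> *\<^sub>R a' + \<beta> *\<^sub>R b' \<noteq> 0" if "\<alpha> > 0" "\<beta> > 0" for \<alpha> \<beta>
    proof
      assume "\<alpha> *\<^sub>R a' + \<beta> *\<^sub>R b' = 0"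
      then have "\<alpha> *\<^sub>R a' = (- \<beta>) *\<^sub>R b'" by (simp add: add_eq_0_iff2)
      then have "proj_pt (\<alpha> *\<^sub>R a') = proj_pt ((- \<beta>) *\<^sub>R b')" by simp
      then show False using that ab'(3) proj_pt_scale[of \<alpha> a'] proj_pt_scale[of "- \<beta>" b'] by simp
    qed
    have fnz: "\<alpha> * (f \<bullet> a') + \<beta> * (f \<bullet> b') \<noteq> 0" if "\<alpha> > 0" "\<beta> > 0" for \<alpha> \<beta>
    proof -
      have "proj_pt (\<alpha> *\<^sub>R a' + \<beta> *\<^sub>R b') \<in> chart_dom f" using 2(2) closure_dom that s' by blast
      then show ?thesis using proj_pt_in_chart_dom[OF nz'[OF that], of f] by (simp add: inner_add_right)
    qed
    \<comment> \<open>With opposite signs, some positive combination would be killed by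
      \<open>f\<close>, giving a point of the segment outside the chart.\<close>
    have noopp: False if "p * q < 0" "p = f \<bullet> a'" "q = f \<bullet> b'" for p q
    proof -
      have "\<bar>q\<bar> * p + \<bar>p\<bar> * q = 0" "p \<noteq> 0" "q \<noteq> 0"
        using that(1) by (auto simp: mult_less_0_iff abs_if)
      then show False using fnz[of "\<bar>q\<bar>" "\<bar>p\<bar>"] that by simp
    qed
    \<comment> \<open>A common sign change moves both representatives to the nonnegative side of
      \<open>f\<close>.\<close>
    define g where "g = (if f \<bullet> a' + f \<bullet> b' > 0 then 1 else - 1 :: real)"
    define a where "a = g *\<^sub>R a'"
    define b where "b = g *\<^sub>R b'"
    have g: "g \<noteq> 0" by (simp add: g_def)
    have sum_pos: "f \<bullet> a + f \<bullet> b > 0"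
      using fnz[of 1 1] by (auto simp: a_def b_def g_def)
    have "\<not> (f \<bullet> a) * (f \<bullet> b) < 0"
      using noopp by (auto simp: a_def b_def g_def split: if_splits)
    then have fab: "f \<bullet> a \<ge> 0" "f \<bullet> b \<ge> 0"
      using sum_pos by (auto simp: not_less zero_le_mult_iff)
    have pg: "proj_pt (\<alpha> *\<^sub>R a + \<beta> *\<^sub>R b) = proj_pt (\<alpha> *\<^sub>R a' + \<beta> *\<^sub>R b')" for \<alpha> \<beta>
    proof -
      have "\<alpha> *\<^sub>R a + \<beta> *\<^sub>R b = g *\<^sub>R (\<alpha> *\<^sub>R a' + \<beta> *\<^sub>R b')" by (simp add: a_def b_def algebra_simps)
      then show ?thesis using proj_pt_scale[OF g] by metis
    qed
    have combK: "\<alpha> *\<^sub>R a + \<beta> *\<^sub>R b \<in> K" "\<alpha> *\<^sub>R a + \<beta> *\<^sub>R b \<noteq> 0" if "\<alpha> > 0" "\<beta> > 0" for \<alpha> \<beta>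
    proof -
      have "\<alpha> * (f \<bullet> a) + \<beta> * (f \<bullet> b) \<noteq> 0"
        using fnz[OF that] g by (simp add: a_def b_def mult.left_commute[of _ g] flip: distrib_left)
      moreover have "\<alpha> * (f \<bullet> a) + \<beta> * (f \<bullet> b) \<ge> 0" using that fab by simp
      ultimately have fp: "f \<bullet> (\<alpha> *\<^sub>R a + \<beta> *\<^sub>R b) > 0" by (simp add: inner_add_right)
      then show nz: "\<alpha> *\<^sub>R a + \<beta> *\<^sub>R b \<noteq> 0" by auto
      have "proj_pt (\<alpha> *\<^sub>R a + \<beta> *\<^sub>R b) \<in> closure \<Omega>" using 2(2) that unfolding pg s' by blast
      then show "\<alpha> *\<^sub>R a + \<beta> *\<^sub>R b \<in> K" using K_iff[OF nz] fp by simp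
    qed
    \<comment> \<open>The end points of the segment are limits of its points.\<close>
    have ray: "a + e *\<^sub>R b \<in> K" "b + e *\<^sub>R a \<in> K" if "e > 0" for e
      using combK(1)[of 1 e] combK(1)[of e 1] that by (simp_all add: add.commute)
    have "a \<in> closure K" using ray(1) by (rule closure_of_ray)
    moreover have "b \<in> closure K" using ray(2) by (rule closure_of_ray)
    ultimately have abK: "a \<in> K" "b \<in> K" by simp_all
    have rep: "\<exists>\<alpha>>0. \<exists>\<beta>>0. z = \<alpha> *\<^sub>R a + \<beta> *\<^sub>R b" if z: "z \<in> K" "z \<noteq> 0" "proj_pt z \<in> s" for z
    proof -
      obtain \<alpha> \<beta> where ab: "\<alpha> > 0" "\<beta> > 0" "proj_pt z = proj_pt (\<alpha> *\<^sub>R a + \<beta> *\<^sub>R b)"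
        using z(3) unfolding s' pg by blast
      obtain c where "c > 0" "z = c *\<^sub>R (\<alpha> *\<^sub>R a + \<beta> *\<^sub>R b)"
        using proj_pt_eq_K[OF z(1) combK(1)[OF ab(1,2)] z(2) combK(2)[OF ab(1,2)] ab(3)] by blast
      then show ?thesis using ab by (intro exI[of _ "c * \<alpha>"] conjI exI[of _ "c * \<beta>"]) (auto simp: scaleR_add_right)
    qed
    obtain p q where pq: "p > 0" "q > 0" "x = p *\<^sub>R a + q *\<^sub>R b" using rep[OF x 2(3)] by blast
    obtain p' q' where pq': "p' > 0" "q' > 0" "w = p' *\<^sub>R a + q' *\<^sub>R b" using rep[OF w 2(4)] by blast
    have sub: "\<exists>d>0. (p *\<^sub>R a + q *\<^sub>R b) - d *\<^sub>R (p' *\<^sub>R a + q' *\<^sub>R b) \<in> K"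
      if "p > 0" "q > 0" "p' > 0" "q' > 0" for p q p' q' :: real
    proof -
      define d where "d = min (p / p') (q / q')"
      have "d > 0" "d * p' \<le> p" "d * q' \<le> q"
        using that by (auto simp: d_def min_def field_simps)
      moreover have "(p *\<^sub>R a + q *\<^sub>R b) - d *\<^sub>R (p' *\<^sub>R a + q' *\<^sub>R b) = (p - d * p') *\<^sub>R a + (q - d * q') *\<^sub>R b"
        by (simp add: algebra_simps)
      ultimately show ?thesis using abK by (intro exI[of _ d]) (auto intro!: K_add K_scale)
    qed
    obtain d where "d > 0" "x - d *\<^sub>R w \<in> K" using sub[OF pq(1,2) pq'(1,2)] pq pq' by blast
    moreover obtain e where "e > 0" "w - e *\<^sub>R x \<in> K" using sub[OF pq'(1,2) pq(1,2)] pq pq' by blast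
    ultimately show ?thesis using x w face_eqI by blast
  qed
qed

lemma lift_face:
  assumes x: "x \<in> K" "x \<noteq> 0"
  shows "lift f (face_at \<Omega> (proj_pt x)) = {w \<in> K. w \<noteq> 0 \<and> face_eq x w}"
proof -
  have "w \<in> lift f (face_at \<Omega> (proj_pt x)) \<longleftrightarrow> w \<in> K \<and> w \<noteq> 0 \<and> face_eq x w" for w
  proof (cases "w \<in> K \<and> w \<noteq> 0")
    case True
    then show ?thesis using face_at_iff[OF x, of w] closure_pos[of w] by (simp add: mem_lift)
  next
    case False
    have "face_at \<Omega> (proj_pt x) \<subseteq> closure \<Omega>" using K_iff x by (auto simp: face_at_def)
    then have "w \<notin> lift f (face_at \<Omega> (proj_pt x))" using False K_iff[of w] by (force simp: mem_lift)
    then show ?thesis using False by blast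
  qed
  then show ?thesis by blast
qed

text \<open>This lets the face be studied with the functional of the domain. Boundedness comes from
  \<open>norm_le\<close>; for convexity, the smaller of the two domination constants serves every
  point between.\<close>

lemma convex_chart_face:
  assumes x: "x \<in> K" "x \<noteq> 0"
  shows "convex_chart (face_at \<Omega> (proj_pt x)) f"
proof -
  let ?E = "face_at \<Omega> (proj_pt x)"
  have E: "?E \<subseteq> closure \<Omega>" using K_iff x by (auto simp: face_at_def)
  then have clE: "closure ?E \<subseteq> closure \<Omega>" by (simp add: closure_minimal)
  have lift: "v \<in> lift f ?E \<longleftrightarrow> v \<in> K \<and> v \<noteq> 0 \<and> face_eq x v" for v using lift_face[OF x] by blast
  have img: "chart f ` ?E = {v. f \<bullet> v = 1 \<and> v \<in> lift f ?E}"
  proof (intro set_eqI iffI)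
    fix v assume "v \<in> chart f ` ?E"
    then obtain p where p: "p \<in> ?E" "v = chart f p" by blast
    then obtain u where u: "f \<bullet> u > 0" "p = proj_pt u" using E closure_dom by (blast elim: proj_cases_pos)
    then show "v \<in> {v. f \<bullet> v = 1 \<and> v \<in> lift f ?E}"
      using p by (simp add: chart_proj_pt mem_lift proj_pt_scale)
  next
    fix v assume "v \<in> {v. f \<bullet> v = 1 \<and> v \<in> lift f ?E}"
    then have v: "proj_pt v \<in> ?E" "f \<bullet> v = 1" by (auto simp: mem_lift)
    then have "v = chart f (proj_pt v)" by (simp add: chart_proj_pt)
    with v show "v \<in> chart f ` ?E" by blast
  qed
  obtain c where c: "c > 0" "\<forall>x\<in>K. norm x \<le> c * (f \<bullet> x)" using norm_le by blast
  have "bounded (chart f ` ?E)"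
    unfolding img bounded_iff using c(2) lift by (intro exI[of _ c]) fastforce
  moreover have "convex (chart f ` ?E)"
  proof (rule convexI)
    fix a b and s t :: real
    assume a: "a \<in> chart f ` ?E" and b: "b \<in> chart f ` ?E" and st: "0 \<le> s" "0 \<le> t" "s + t = 1"
    have aK: "a \<in> K" "face_eq x a" "f \<bullet> a = 1" and bK: "b \<in> K" "face_eq x b" "f \<bullet> b = 1"
      using a b unfolding img lift by auto
    obtain d where d: "d > 0" "x - d *\<^sub>R a \<in> K" "a - d *\<^sub>R x \<in> K" using aK(2) unfolding face_eq_def by blast
    obtain e where e: "e > 0" "x - e *\<^sub>R b \<in> K" "b - e *\<^sub>R x \<in> K" using bK(2) unfolding face_eq_def by blast
    define h where "h = min d e"
    have h: "h > 0" "h \<le> d" "h \<le> e" using d e by (auto simp: h_def)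
    have K: "s *\<^sub>R a + t *\<^sub>R b \<in> K" using aK bK st by (intro K_add K_scale) auto
    have f1: "f \<bullet> (s *\<^sub>R a + t *\<^sub>R b) = 1" using aK bK st by (simp add: inner_add_right)
    have s1: "s = 1 - t" using st by simp
    have "s *\<^sub>R (x - d *\<^sub>R a) + t *\<^sub>R (x - e *\<^sub>R b) + ((d - h) * s) *\<^sub>R a + ((e - h) * t) *\<^sub>R b \<in> K"
      "s *\<^sub>R (a - d *\<^sub>R x) + t *\<^sub>R (b - e *\<^sub>R x) + ((d - h) * s) *\<^sub>R x + ((e - h) * t) *\<^sub>R x \<in> K"
      using d e h st aK bK x by (intro K_add K_scale; simp)+
    then have "x - h *\<^sub>R (s *\<^sub>R a + t *\<^sub>R b) \<in> K" "(s *\<^sub>R a + t *\<^sub>R b) - h *\<^sub>R x \<in> K"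
      unfolding s1 by (simp_all add: algebra_simps)
    then have "face_eq x (s *\<^sub>R a + t *\<^sub>R b)" unfolding face_eq_def using h by blast
    moreover have "s *\<^sub>R a + t *\<^sub>R b \<noteq> 0" using f1 by auto
    ultimately show "s *\<^sub>R a + t *\<^sub>R b \<in> chart f ` ?E" unfolding img lift using K f1 by simp
  qed
  ultimately show ?thesis
    using chart clE unfolding convex_chart_def by blast
qed

text \<open>\<open>B\<close> is the chart image of the compact set, and \<open>T\<close> is the
  inverse matrix divided by the value of \<open>f\<close> that it produces at \<open>z\<close>. This
  division also fixes the sign, so that \<open>T\<close> preserves \<open>I\<close> instead of
  mapping it to its negative.\<close>

lemma quasi_homogeneous_coneI:
  assumes "quasi_homogeneous \<Omega>"
  shows quasi_homogeneous_cone
proof -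
  obtain C where C: "compact C" "C \<subseteq> \<Omega>" "(\<Union>g\<in>Aut \<Omega>. g ` C) = \<Omega>"
    using assms unfolding quasi_homogeneous_def by blast
  define B where "B = chart f ` C"
  have dom: "\<Omega> \<subseteq> chart_dom f" using closure_dom closure_subset by blast
  have "compact B" unfolding B_def using C(1,2) dom
    by (intro compact_continuous_image continuous_on_subset[OF continuous_on_chart]) auto
  moreover have "B \<subseteq> I"
  proof
    fix b assume "b \<in> B"
    then obtain p where p: "p \<in> \<Omega>" "b = chart f p" using C(2) by (auto simp: B_def)
    then obtain v where "f \<bullet> v > 0" "p = proj_pt v" using dom by (blast elim: proj_cases_pos)
    then show "b \<in> I" using p by (simp add: chart_proj_pt mem_lift proj_pt_scale)
  qed
  moreover have "\<exists>T. linear T \<and> T z \<in> B \<and> T ` K \<subseteq> K \<and> (\<forall>v. T v \<in> I \<longrightarrow> v \<in> I)" if z: "z \<in> I" for z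
  proof -
    obtain g c where g: "g \<in> Aut \<Omega>" "c \<in> C" "proj_pt z = g c"
      using C(3) I_in_domain[OF z] by blast
    then obtain A where A: "invertible A" "g = proj_map A" "proj_map A ` \<Omega> = \<Omega>"
      unfolding Aut_def PGL_def by blast
    obtain A' where "A ** A' = mat 1" "A' ** A = mat 1"
      using A(1) unfolding invertible_def by blast
    then have inv: "A *v (A' *v v) = v" "A' *v (A *v v) = v" for v
      by (simp_all add: matrix_vector_mul_assoc)
    have nz: "A' *v v \<noteq> 0 \<longleftrightarrow> v \<noteq> 0" for v using inv[of v] by force
    have dom_iff: "proj_pt (A' *v v) \<in> \<Omega> \<longleftrightarrow> proj_pt v \<in> \<Omega>" if v: "v \<noteq> 0" for v
    proof
      assume "proj_pt (A' *v v) \<in> \<Omega>"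
      then have "proj_map A (proj_pt (A' *v v)) \<in> \<Omega>" using A(3) by blast
      then show "proj_pt v \<in> \<Omega>" using proj_map_proj_pt[of "A' *v v" A] nz v inv by simp
    next
      assume "proj_pt v \<in> \<Omega>"
      then obtain p where p: "p \<in> \<Omega>" "proj_pt v = proj_map A p" using A(3) by blast
      obtain u where u: "u \<noteq> 0" "p = proj_pt u" by (rule proj_cases)
      have "A *v u \<noteq> 0" using inv[of u] u by force
      then obtain r where r: "r \<noteq> 0" "v = r *\<^sub>R (A *v u)"
        using proj_pt_eqD[of v "A *v u"] p u v by (auto simp: proj_map_proj_pt)
      have "A' *v v = r *\<^sub>R u" using inv[of u] by (simp add: r matrix_vector_mult_scaleR)
      then show "proj_pt (A' *v v) \<in> \<Omega>" using u p r by (simp add: proj_pt_scale)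
    qed
    have zn: "z \<noteq> 0" using z I_nonzero by blast
    have fz: "f \<bullet> (A' *v z) \<noteq> 0"
      using dom_iff[OF zn] z dom proj_pt_in_chart_dom[of "A' *v z" f] nz zn by (auto simp: mem_lift)
    define T where "T = (\<lambda>v. (1 / (f \<bullet> (A' *v z))) *\<^sub>R (A' *v v))"
    have lin: "linear T" unfolding T_def
      by (intro linear_compose_scale_right matrix_vector_mul_linear)
    have T_nz: "T v \<noteq> 0 \<longleftrightarrow> v \<noteq> 0" for v using fz nz by (simp add: T_def)
    have T_dom: "proj_pt (T v) \<in> \<Omega> \<longleftrightarrow> proj_pt v \<in> \<Omega>" if "v \<noteq> 0" for v
      using dom_iff[OF that] fz by (simp add: T_def proj_pt_scale)
    have fTz: "f \<bullet> T z = 1" using fz by (simp add: T_def)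
    have "T z \<in> B"
    proof -
      obtain u where u: "u \<noteq> 0" "c = proj_pt u" by (rule proj_cases)
      have "A *v u \<noteq> 0" using inv[of u] u by force
      then obtain r where r: "r \<noteq> 0" "z = r *\<^sub>R (A *v u)"
        using proj_pt_eqD[of z "A *v u"] g A u zn by (auto simp: proj_map_proj_pt)
      have "A' *v z = r *\<^sub>R u" using inv[of u] by (simp add: r matrix_vector_mult_scaleR)
      then have "proj_pt (T z) = c" using u r fz by (simp add: T_def proj_pt_scale)
      moreover have "T z = chart f (proj_pt (T z))" using fTz by (simp add: chart_proj_pt)
      ultimately show ?thesis unfolding B_def using g(2) by blast
    qed
    \<comment> \<open>\<open>f \<circ> T\<close> does not vanish on the convex set \<open>I\<close> and is positive at \<open>z\<close>.\<close>
    have TI: "T v \<in> I" if v: "v \<in> I" for v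
    proof (rule ccontr)
      assume "T v \<notin> I"
      then have neg: "f \<bullet> T v \<le> 0" using T_dom[OF I_nonzero[OF v]] I_in_domain[OF v] by (auto simp: mem_lift)
      define y where "y = v + (- (f \<bullet> T v)) *\<^sub>R z"
      have "y \<in> I" unfolding y_def using v z neg by (intro I_K_add K_scale I_K) auto
      then have "proj_pt (T y) \<in> chart_dom f"
        using T_dom[OF I_nonzero] I_in_domain dom by blast
      moreover have "f \<bullet> T y = 0"
        using fTz by (simp add: y_def linear_add[OF lin] linear_scale[OF lin] linear_diff[OF lin] inner_add_right inner_diff_right)
      ultimately show False
        using proj_pt_in_chart_dom[of "T y" f] T_nz I_nonzero[OF \<open>y \<in> I\<close>] by blast
    qed
    have "T ` K \<subseteq> K"
    proof -
      have "T ` closure I \<subseteq> closure (T ` I)"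
        by (rule continuous_image_closure_subset[of UNIV])
          (auto intro: linear_continuous_on linear_conv_bounded_linear[THEN iffD1] lin)
      also have "\<dots> \<subseteq> K" using TI by (intro closure_mono) auto
      finally show ?thesis .
    qed
    moreover have "v \<in> I" if Tv: "T v \<in> I" for v
    proof -
      have vn: "v \<noteq> 0" using T_nz I_nonzero[OF Tv] by blast
      have dv: "proj_pt v \<in> \<Omega>" using T_dom[OF vn] Tv by (simp add: mem_lift)
      have fv: "f \<bullet> v \<noteq> 0" using dv dom proj_pt_in_chart_dom[OF vn] by blast
      show ?thesis
      proof (cases "f \<bullet> v > 0")
        case False
        then have "- v \<in> I" using dv fv by (simp add: mem_lift)
        from TI[OF this] have "- T v \<in> I" by (simp add: linear_neg[OF lin])
        then show ?thesis using Tv by (auto simp: mem_lift)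
      qed (use dv in \<open>simp add: mem_lift\<close>)
    qed
    ultimately show ?thesis using lin \<open>T z \<in> B\<close> by blast
  qed
  ultimately show ?thesis unfolding quasi_homogeneous_cone_def by blast
qed

lemma PES_simplicial: "PES \<Omega> k v \<Longrightarrow> \<exists>u. simplicial k u"
  using PES_imp_cone[OF chart] unfolding simplicial_iff_conic by metis

lemma simplicial_PES: "simplicial k u \<Longrightarrow> k \<ge> 1 \<Longrightarrow> PES \<Omega> k (\<lambda>i. proj_pt (u i))"
  using cone_imp_PES[OF chart] unfolding simplicial_iff_conic by blast

lemma facet_proj_pt:
  assumes "k \<ge> 1" "\<And>i. i \<le> k \<Longrightarrow> V i \<in> I"
  shows "facet \<Omega> k (\<lambda>i. proj_pt (V i)) j = proj_pt ` (conic V ({..k} - {j}) - {0})"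
proof -
  have "{..k} - {j} \<noteq> {}" using assms(1) by (cases j) force+
  then show ?thesis unfolding facet_def
    using assms I_K I_nonzero by (intro CH_proj_pt[OF chart]) auto
qed

lemma conic_in_I:
  fixes k :: nat
  assumes V: "\<And>i. i \<le> k \<Longrightarrow> V i \<in> I" and z: "z \<in> conic V ({..k} - {j})" "z \<noteq> 0"
  shows "z \<in> I"
proof -
  obtain c where c: "\<forall>i\<in>{..k} - {j}. 0 \<le> c i" "z = (\<Sum>i\<in>{..k} - {j}. c i *\<^sub>R V i)"
    using z(1) by (rule conicE)
  obtain i where i: "i \<in> {..k} - {j}" "c i \<noteq> 0"
  proof (rule ccontr)
    assume "\<not> thesis"
    then have "\<forall>i\<in>{..k} - {j}. c i *\<^sub>R V i = 0" using that by auto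
    then show False using z(2) c(2) by (simp add: sum.neutral)
  qed
  have "z = c i *\<^sub>R V i + (\<Sum>l\<in>{..k} - {j} - {i}. c l *\<^sub>R V l)"
    unfolding c(2) using i by (intro sum.remove) auto
  moreover have "c i *\<^sub>R V i \<in> I" using c i V by (intro scale) (auto simp: less_le)
  moreover have "(\<Sum>l\<in>{..k} - {j} - {i}. c l *\<^sub>R V l) \<in> K"
    using c V by (intro K_sum K_scale I_K) auto
  ultimately show ?thesis using I_K_add by simp
qed

end

section \<open>The equivalences\<close>

lemma r_PES_le_iff: "r_PES W \<le> enat m \<longleftrightarrow> (\<forall>k v. PES W k v \<longrightarrow> k \<le> m)"
  unfolding r_PES_def SUP_le_iff by auto

section \<open>Slim simplices, PES and faces\<close>

context convex_domain
begin

text \<open>The bound \<open>a * b \<le> exp (- 2 * \<delta>)\<close> means Hilbert distance at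
  least \<open>\<delta>\<close>, so \<open>x\<close> on facet 0 escapes the neighbourhoods of all
  other facets.\<close>

lemma not_slim_of_simplicial:
  assumes f: "f = chart_of \<Omega>" and k: "k \<ge> 1" and s: "simplicial k u"
  shows "\<exists>v. compact_simplex \<Omega> k v \<and> \<not> slim \<Omega> \<delta> k v"
proof -
  obtain V x where V: "\<And>i. i \<le> k \<Longrightarrow> V i \<in> I" and x: "x \<in> I" "x \<in> conic V ({..k} - {0})"
    and far: "\<And>j q a b. j \<le> k \<Longrightarrow> j \<noteq> 0 \<Longrightarrow> q \<in> conic V ({..k} - {j}) \<Longrightarrow> 0 < a \<Longrightarrow> 0 < b \<Longrightarrow>
       q - a *\<^sub>R x \<in> K \<Longrightarrow> x - b *\<^sub>R q \<in> K \<Longrightarrow> a * b \<le> exp (- 2 * \<delta>)"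
    using thick_of_simplicial[OF s k, of "exp (- 2 * \<delta>)"] by auto
  define v where "v = (\<lambda>i. proj_pt (V i))"
  have fac: "facet \<Omega> k v j = proj_pt ` (conic V ({..k} - {j}) - {0})" for j
    unfolding v_def using k V by (rule facet_proj_pt)
  have "compact_simplex \<Omega> k v"
    using k V I_in_domain by (auto simp: compact_simplex_def v_def)
  moreover have "\<not> slim \<Omega> \<delta> k v"
  proof
    assume "slim \<Omega> \<delta> k v"
    then have "facet \<Omega> k v 0 \<subseteq> (\<Union>j\<in>{..k} - {0}. nbhd \<Omega> \<delta> (facet \<Omega> k v j))" by (simp add: slim_def)
    moreover have "proj_pt x \<in> facet \<Omega> k v 0" unfolding fac using x I_nonzero by blast
    ultimately obtain j where j: "j \<in> {..k} - {0}" "proj_pt x \<in> nbhd \<Omega> \<delta> (facet \<Omega> k v j)" by blast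
    \<comment> \<open>The facet must be nonempty before an infimum below \<open>\<delta>\<close>
      yields a point at distance below \<open>\<delta>\<close>.\<close>
    have "V 0 \<in> conic V ({..k} - {j})" using j by (intro conic_generator) auto
    then have "facet \<Omega> k v j \<noteq> {}" unfolding fac using V[of 0] I_nonzero by blast
    moreover have "(INF y\<in>facet \<Omega> k v j. hilbert_dist \<Omega> (proj_pt x) y) < \<delta>"
      using j by (simp add: nbhd_def)
    ultimately obtain y where "y \<in> facet \<Omega> k v j" "hilbert_dist \<Omega> (proj_pt x) y < \<delta>"
      using cInf_lessD by (metis (no_types, lifting) empty_is_image imageE)
    then obtain q where q: "q \<in> conic V ({..k} - {j})" "q \<noteq> 0"
      "hilbert_dist \<Omega> (proj_pt x) (proj_pt q) < \<delta>" unfolding fac by auto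
    have "q \<in> I" using conic_in_I[OF V q(1,2)] .
    then obtain a b where ab: "0 < a" "0 < b" "x - a *\<^sub>R q \<in> K" "q - b *\<^sub>R x \<in> K"
      "hilbert_dist \<Omega> (proj_pt x) (proj_pt q) = - ln (a * b) / 2"
      using hilbert_dist_attained[OF f x(1)] by metis
    have "b * a \<le> exp (- 2 * \<delta>)" using far[OF _ _ q(1) ab(2,1,4,3)] j by simp
    then have "ln (b * a) \<le> - 2 * \<delta>" using ab(1,2) by (metis ln_exp ln_mono mult_pos_pos)
    then show False using q(3) ab(5) by (simp add: mult.commute)
  qed
  ultimately show ?thesis by blast
qed

text \<open>Grouping the vertices of the facet opposite \<open>v i\<close> into \<open>m + 1\<close> blocks replaces a
  \<open>k\<close>-simplex that is not slim by a family of the size that \<open>simplicial_of_thick\<close> needs.\<close>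

lemma not_slim_imp_thick:
  assumes f: "f = chart_of \<Omega>" and k: "k \<ge> m + 1" and c: "compact_simplex \<Omega> k v"
    and ns: "\<not> slim \<Omega> (real n + 1) k v"
  shows "\<exists>v p. v \<in> I \<and> (\<forall>i\<le>m. p i \<in> K) \<and> (\<Sum>i\<le>m. p i) \<in> I \<and>
     (\<forall>i t a b. i \<le> m \<longrightarrow> 0 < t \<longrightarrow> 0 < a \<longrightarrow> 0 < b \<longrightarrow>
      (v + t *\<^sub>R ((\<Sum>i\<le>m. p i) - p i)) - a *\<^sub>R (\<Sum>i\<le>m. p i) \<in> K \<longrightarrow>
      (\<Sum>i\<le>m. p i) - b *\<^sub>R (v + t *\<^sub>R ((\<Sum>i\<le>m. p i) - p i)) \<in> K \<longrightarrow>
      a * b \<le> exp (- 2 * real n))"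
proof -
  have "\<forall>i. \<exists>w. i \<le> k \<longrightarrow> w \<in> I \<and> v i = proj_pt w"
    using c by (metis compact_simplex_def obtain_I)
  then obtain V where V: "\<And>i. i \<le> k \<Longrightarrow> V i \<in> I" and vV: "\<And>i. i \<le> k \<Longrightarrow> v i = proj_pt (V i)" by metis
  have "facet \<Omega> k v j = facet \<Omega> k (\<lambda>i. proj_pt (V i)) j" for j
    unfolding facet_def using vV by (intro arg_cong[of _ _ "CH \<Omega>"] image_cong) auto
  then have fac: "facet \<Omega> k v j = proj_pt ` (conic V ({..k} - {j}) - {0})" for j
    using facet_proj_pt[OF _ V] k by simp
  obtain i0 y where i0: "i0 \<le> k" "y \<in> facet \<Omega> k v i0"
    and y: "\<And>j. j \<in> {..k} - {i0} \<Longrightarrow> y \<notin> nbhd \<Omega> (real n + 1) (facet \<Omega> k v j)"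
    using ns unfolding slim_def by blast
  obtain x where x: "x \<in> conic V ({..k} - {i0})" "x \<noteq> 0" "y = proj_pt x"
    using i0 unfolding fac by blast
  have xI: "x \<in> I" using conic_in_I[OF V x(1,2)] .
  have far: "real n + 1 \<le> hilbert_dist \<Omega> (proj_pt x) (proj_pt q)"
    if j: "j \<in> {..k} - {i0}" and q: "q \<in> conic V ({..k} - {j})" "q \<noteq> 0" for j q
  proof -
    have "0 \<le> hilbert_dist \<Omega> (proj_pt x) z" if z: "z \<in> facet \<Omega> k v j" for z
    proof -
      obtain q where q: "q \<in> conic V ({..k} - {j})" "q \<noteq> 0" "z = proj_pt q"
        using z unfolding fac by blast
      show ?thesis unfolding q(3) by (rule hilbert_dist_nonneg[OF f xI conic_in_I[OF V q(1,2)]])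
    qed
    then have "bdd_below (hilbert_dist \<Omega> (proj_pt x) ` facet \<Omega> k v j)" by (intro bdd_belowI2[of _ 0])
    moreover have "proj_pt q \<in> facet \<Omega> k v j" using q unfolding fac by blast
    ultimately have "(INF z\<in>facet \<Omega> k v j. hilbert_dist \<Omega> (proj_pt x) z) \<le> hilbert_dist \<Omega> (proj_pt x) (proj_pt q)"
      by (rule cINF_lower)
    moreover have "\<not> (INF z\<in>facet \<Omega> k v j. hilbert_dist \<Omega> (proj_pt x) z) < real n + 1"
      using y[OF j] I_in_domain[OF xI] x(3) by (simp add: nbhd_def)
    ultimately show ?thesis by simp
  qed
  obtain c where c: "\<forall>i\<in>{..k} - {i0}. 0 \<le> c i" "x = (\<Sum>i\<in>{..k} - {i0}. c i *\<^sub>R V i)"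
    using x(1) by (rule conicE)
  define L where "L = {..k} - {i0}"
  have L: "finite L" "card L = k" using i0 by (auto simp: L_def)
  obtain e where e: "bij_betw e L {0..<k}" using ex_bij_betw_finite_nat[OF L(1)] L(2) by metis
  \<comment> \<open>The first \<open>m\<close> vertices in the enumeration form blocks of their own
    and all others share block \<open>m\<close>. As \<open>k \<ge> m + 1\<close>, no block is
    empty.\<close>
  define g where "g = (\<lambda>l. min (e l) m)"
  have gL: "g ` L \<subseteq> {..m}" by (auto simp: g_def)
  have rep: "\<exists>r\<in>L. g r = i" if "i \<le> m" for i
  proof -
    have "i \<in> e ` L" using e that k by (simp add: bij_betw_def)
    then obtain r where "r \<in> L" "e r = i" by blast
    then show ?thesis using that by (intro bexI[of _ r]) (simp_all add: g_def)
  qed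
  define p where "p = (\<lambda>i. \<Sum>l\<in>{l\<in>L. g l = i}. c l *\<^sub>R V l)"
  have sump: "(\<Sum>i\<le>m. p i) = x"
    unfolding p_def c(2) L_def[symmetric] using L gL by (intro sum.group) auto
  have pK: "p i \<in> K" for i
    unfolding p_def using c V by (intro K_sum K_scale I_K) (auto simp: L_def)
  have "a * b \<le> exp (- 2 * real n)"
    if i: "i \<le> m" and t: "0 < t" and ab: "0 < a" "0 < b"
      and 1: "(V i0 + t *\<^sub>R (x - p i)) - a *\<^sub>R x \<in> K" and 2: "x - b *\<^sub>R (V i0 + t *\<^sub>R (x - p i)) \<in> K"
    for i t a b
  proof -
    obtain r where r: "r \<in> L" "g r = i" using rep[OF i] by blast
    define q where "q = V i0 + t *\<^sub>R (x - p i)"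
    have "x = (\<Sum>l\<in>{l\<in>L. g l = i} \<union> {l\<in>L. g l \<noteq> i}. c l *\<^sub>R V l)"
      unfolding c(2) L_def[symmetric] by (rule sum.cong) auto
    also have "\<dots> = p i + (\<Sum>l\<in>{l\<in>L. g l \<noteq> i}. c l *\<^sub>R V l)"
      unfolding p_def using L(1) by (intro sum.union_disjoint) auto
    finally have xp: "x - p i = (\<Sum>l\<in>{l\<in>L. g l \<noteq> i}. c l *\<^sub>R V l)" by simp
    \<comment> \<open>The vertex \<open>r\<close> belongs to block \<open>i\<close>, which is absent
      from \<open>x - p i\<close>. Hence \<open>q\<close> lies on the facet opposite
      \<open>r\<close>, from which \<open>x\<close> is far.\<close>
    have xpC: "x - p i \<in> conic V ({..k} - {r})"
      unfolding xp using c(1) r by (intro conic_sum conic_scale conic_generator) (auto simp: L_def)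
    moreover have "V i0 \<in> conic V ({..k} - {r})"
      using r i0 by (intro conic_generator) (auto simp: L_def)
    ultimately have q: "q \<in> conic V ({..k} - {r})"
      unfolding q_def using t by (intro conic_add conic_scale) auto
    have "x - p i \<in> K" by (rule conic_K[OF _ xpC]) (use V I_K in auto)
    then have qI: "q \<in> I" unfolding q_def using V[OF i0(1)] t by (intro I_K_add K_scale) auto
    have "real n + 1 \<le> hilbert_dist \<Omega> (proj_pt x) (proj_pt q)"
      using far[OF _ q I_nonzero[OF qI]] r by (simp add: L_def)
    also have "\<dots> \<le> - ln (b * a) / 2"
      using hilbert_dist_le[OF f xI qI ab(2,1)] 1 2 by (simp add: q_def)
    finally have "ln (a * b) \<le> - 2 * real n" by (simp add: mult.commute)
    then have "exp (ln (a * b)) \<le> exp (- 2 * real n)" by simp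
    then show ?thesis using ab by simp
  qed
  then show ?thesis
    using V[OF i0(1)] pK xI by (intro exI[of _ "V i0"] exI[of _ p]) (simp add: sump)
qed

text \<open>The dimension \<open>k\<close> of the failing simplices may vary with the constant, but
  grouping yields families of the fixed size \<open>m + 1\<close>, to which the limit argument
  applies.\<close>

lemma PES_of_not_slim:
  assumes f: "f = chart_of \<Omega>" and qh: "quasi_homogeneous \<Omega>"
    and ns: "\<not> (\<exists>\<delta>>0. \<forall>k\<ge>m + 1. \<forall>v. compact_simplex \<Omega> k v \<longrightarrow> slim \<Omega> \<delta> k v)"
  shows "\<exists>v. PES \<Omega> (Suc m) v"
proof -
  let ?T = "\<lambda>n v p. v \<in> I \<and> (\<forall>i\<le>m. p i \<in> K) \<and> (\<Sum>i\<le>m. p i) \<in> I \<and>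
     (\<forall>i t a b. i \<le> m \<longrightarrow> 0 < t \<longrightarrow> 0 < a \<longrightarrow> 0 < b \<longrightarrow>
      (v + t *\<^sub>R ((\<Sum>i\<le>m. p i) - p i)) - a *\<^sub>R (\<Sum>i\<le>m. p i) \<in> K \<longrightarrow>
      (\<Sum>i\<le>m. p i) - b *\<^sub>R (v + t *\<^sub>R ((\<Sum>i\<le>m. p i) - p i)) \<in> K \<longrightarrow>
      a * b \<le> exp (- 2 * real n))"
  have "\<exists>v p. ?T n v p" for n
  proof -
    \<comment> \<open>The shift by one keeps the slimness constant positive for
      \<open>n = 0\<close>.\<close>
    have "real n + 1 > 0" by simp
    then obtain k v where "k \<ge> m + 1" "compact_simplex \<Omega> k v" "\<not> slim \<Omega> (real n + 1) k v"
      using ns by blast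
    then show ?thesis by (rule not_slim_imp_thick[OF f])
  qed
  then obtain v p where vp: "\<And>n. ?T n (v n) (p n)" by metis
  have "\<exists>u. simplicial (Suc m) u"
    by (rule simplicial_of_thick[OF quasi_homogeneous_coneI[OF qh], of v m p]) (use vp in blast)+
  then show ?thesis using simplicial_PES by force
qed

text \<open>The sum of the lifted vertices is equivalent to the boundary vector \<open>x\<close>, so
  it is not in \<open>I\<close>. The sums with one vertex left out are not in the cone over
  \<open>E\<close>, so they are not equivalent to the full sum.\<close>

lemma PES_of_face:
  assumes qh: "quasi_homogeneous \<Omega>" and E: "open_face \<Omega> E" and P: "PES E k v"
  shows "\<exists>v. PES \<Omega> (Suc k) v"
proof -
  obtain e where e: "e \<in> pboundary \<Omega>" "E = face_at \<Omega> e" using E unfolding open_face_def by blast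
  then obtain x where x: "x \<in> K" "x \<noteq> 0" "e = proj_pt x" unfolding pboundary_def by (blast elim: obtain_K)
  have xI: "x \<notin> I" using e x I_in_domain by (auto simp: pboundary_def)
  have lift: "lift f E = {w \<in> K. w \<noteq> 0 \<and> face_eq x w}" using lift_face[OF x(1,2)] e x by simp
  have "convex_chart E f" using convex_chart_face[OF x(1,2)] e x by simp
  then obtain u where u: "\<forall>i\<le>k. u i \<in> closure (lift f E)" "(\<Sum>i\<le>k. u i) \<in> lift f E"
    "\<forall>j\<le>k. conic u ({..k} - {j}) \<inter> lift f E = {}" using P by (rule PES_imp_cone)
  have "closure (lift f E) \<subseteq> K" unfolding lift by (rule closure_minimal) auto
  then have uK: "u i \<in> K" if "i \<le> k" for i using u(1) that by blast
  have "\<exists>u. simplicial (Suc k) u"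
  proof (rule simplicial_of_face[OF quasi_homogeneous_coneI[OF qh] uK])
    show "(\<Sum>i\<le>k. u i) \<notin> I"
    proof
      assume I: "(\<Sum>i\<le>k. u i) \<in> I"
      obtain d where "d > 0" "x - d *\<^sub>R (\<Sum>i\<le>k. u i) \<in> K"
        using u(2) unfolding lift face_eq_def by blast
      then have "x \<in> I" using I_diff_K scale[OF I] by blast
      then show False using xI by blast
    qed
    fix j assume j: "j \<le> k"
    have eq: "(\<Sum>i\<le>k. u i) - u j = sum u ({..k} - {j})" using j by (simp add: sum_diff1)
    have conic: "sum u ({..k} - {j}) \<in> conic u ({..k} - {j})"
      using conicI[of "{..k} - {j}" "\<lambda>_. 1" u] by simp
    show "\<not> face_eq ((\<Sum>i\<le>k. u i) - u j) (\<Sum>i\<le>k. u i)"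
    proof
      assume fe: "face_eq ((\<Sum>i\<le>k. u i) - u j) (\<Sum>i\<le>k. u i)"
      then have "face_eq x (sum u ({..k} - {j}))"
        using u(2) unfolding lift eq by (blast intro: face_eq_trans face_eq_sym)
      moreover have "sum u ({..k} - {j}) \<in> K" using uK by (intro K_sum) auto
      \<comment> \<open>The cone over \<open>E\<close> contains only nonzero vectors, so zero is
        excluded separately: it dominates no positive multiple of the full sum, where
        \<open>f\<close> is positive.\<close>
      moreover have "sum u ({..k} - {j}) \<noteq> 0"
      proof
        assume 0: "sum u ({..k} - {j}) = 0"
        obtain d where d: "d > 0" "0 - d *\<^sub>R (\<Sum>i\<le>k. u i) \<in> K"
          using fe unfolding eq 0 face_eq_def by blast
        have "d * (f \<bullet> (\<Sum>i\<le>k. u i)) > 0"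
          using u(2) closure_pos d(1) unfolding lift by simp
        then show False using K_nonneg[OF d(2)] by (simp add: inner_diff_right)
      qed
      ultimately show False using u(3) j conic unfolding lift by blast
    qed
  qed
  then show ?thesis using simplicial_PES by force
qed

text \<open>The face is taken through \<open>y\<close>, the sum of the vertices other than
  \<open>u 0\<close>. Those vertices lie only in the closure of its cone, as limits of
  \<open>u (Suc i) + e *\<^sub>R y\<close>.\<close>

lemma face_of_PES:
  assumes P: "PES \<Omega> (Suc k) v" and k: "k \<ge> 1"
  shows "\<exists>E v. open_face \<Omega> E \<and> PES E k v"
proof -
  obtain u where s: "simplicial (Suc k) u" using PES_simplicial[OF P] by blast
  define y where "y = (\<Sum>i\<le>k. u (Suc i))"
  note y = face_of_simplicial[OF s k, folded y_def]
  have uK: "\<And>i. i \<le> Suc k \<Longrightarrow> u i \<in> K" using s by (simp add: simplicial_def)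
  define E where "E = face_at \<Omega> (proj_pt y)"
  have lift: "lift f E = {w \<in> K. w \<noteq> 0 \<and> face_eq y w}" unfolding E_def by (rule lift_face[OF y(1,2)])
  have "proj_pt y \<in> pboundary \<Omega>" using y(1,2,3) K_iff I_iff by (simp add: pboundary_def)
  then have "open_face \<Omega> E" unfolding open_face_def E_def by blast
  moreover have "PES E k (\<lambda>i. proj_pt (u (Suc i)))"
  proof (rule cone_imp_PES[OF _ k, of _ f])
    show "convex_chart E f" unfolding E_def by (rule convex_chart_face[OF y(1,2)])
    show "(\<Sum>i\<le>k. u (Suc i)) \<in> lift f E"
      unfolding y_def[symmetric] lift using y(1,2) face_eq_refl by blast
    show "\<forall>j\<le>k. conic (\<lambda>i. u (Suc i)) ({..k} - {j}) \<inter> lift f E = {}"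
      unfolding lift using y(4) face_eq_sym by blast
    show "\<forall>i\<le>k. u (Suc i) \<in> closure (lift f E)"
    proof (intro allI impI)
      fix i assume i: "i \<le> k"
      have "y - u (Suc i) = (\<Sum>l\<in>{..k} - {i}. u (Suc l))" using i by (simp add: y_def sum_diff1)
      also have "\<dots> \<in> K" using uK by (intro K_sum) auto
      finally have yu: "y - u (Suc i) \<in> K" .
      have "u (Suc i) + e *\<^sub>R y \<in> lift f E" if e: "e > 0" for e
      proof -
        have mem: "u (Suc i) + e *\<^sub>R y \<in> K" using uK i y(1) e by (intro K_add K_scale) auto
        have "f \<bullet> (u (Suc i) + e *\<^sub>R y) > 0"
          using K_nonneg[OF uK[of "Suc i"]] i closure_pos[OF y(1,2)] e by (simp add: inner_add_right add_nonneg_pos)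
        then have nz: "u (Suc i) + e *\<^sub>R y \<noteq> 0" by auto
        \<comment> \<open>This value satisfies \<open>1 - d * e = d\<close>, which reduces the
          domination to that of \<open>u (Suc i)\<close> by \<open>y\<close>.\<close>
        define d where "d = 1 / (1 + e)"
        have d: "d > 0" "1 - d * e = d" using e by (auto simp: d_def field_simps)
        have "y - d *\<^sub>R (u (Suc i) + e *\<^sub>R y) = (1 - d * e) *\<^sub>R y - d *\<^sub>R u (Suc i)"
          by (simp add: algebra_simps)
        also have "\<dots> = d *\<^sub>R (y - u (Suc i))" by (simp add: d(2) scaleR_diff_right)
        also have "\<dots> \<in> K" using yu d by (intro K_scale) auto
        finally have "y - d *\<^sub>R (u (Suc i) + e *\<^sub>R y) \<in> K" .
        moreover have "(u (Suc i) + e *\<^sub>R y) - e *\<^sub>R y \<in> K" using uK i by simp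
        ultimately have "face_eq y (u (Suc i) + e *\<^sub>R y)"
          using e d(1) y(1) mem by (intro face_eqI[of _ d _ e]) auto
        then show ?thesis unfolding lift using mem nz by blast
      qed
      then show "u (Suc i) \<in> closure (lift f E)" by (rule closure_of_ray)
    qed
  qed
  ultimately show ?thesis by blast
qed

end

theorem proposition4p5:
  fixes \<Omega> :: "'d::finite proj set" and m :: nat
  assumes "properly_convex_domain \<Omega>" and "quasi_homogeneous \<Omega>"
    and "1 \<le> m" and "m \<le> CARD('d) - 1"
  shows "(r_PES \<Omega> \<le> enat m \<longleftrightarrow>
            (\<exists>\<delta>>0. \<forall>k\<ge>m + 1. \<forall>v. compact_simplex \<Omega> k v \<longrightarrow> slim \<Omega> \<delta> k v))
       \<and> ((\<exists>\<delta>>0. \<forall>k\<ge>m + 1. \<forall>v. compact_simplex \<Omega> k v \<longrightarrow> slim \<Omega> \<delta> k v) \<longleftrightarrow>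
            (\<forall>E. open_face \<Omega> E \<longrightarrow> r_PES E \<le> enat (m - 1)))"
proof -
  have dom: "\<Omega> \<noteq> {}" "open \<Omega>" and "\<exists>f. convex_chart \<Omega> f"
    using assms(1) unfolding properly_convex_domain_def by blast+
  then have "convex_chart \<Omega> (chart_of \<Omega>)" using convex_chart_chart_of by blast
  then interpret convex_domain \<Omega> "chart_of \<Omega>" using dom by unfold_locales
  have "r_PES \<Omega> \<le> enat m \<longleftrightarrow>
      (\<exists>\<delta>>0. \<forall>k\<ge>m + 1. \<forall>v. compact_simplex \<Omega> k v \<longrightarrow> slim \<Omega> \<delta> k v)" (is "?A \<longleftrightarrow> ?B")
  proof
    assume ?A
    \<comment> \<open>Excluding the single dimension \<open>m + 1\<close> suffices, because failure
      of slimness produces a PES of exactly this dimension.\<close>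
    then have "\<not> PES \<Omega> (Suc m) v" for v unfolding r_PES_le_iff by (metis not_less_eq_eq order_refl)
    then show ?B using PES_of_not_slim[OF refl assms(2), of m] by blast
  next
    assume ?B
    then obtain \<delta> where \<delta>: "\<forall>k\<ge>m + 1. \<forall>v. compact_simplex \<Omega> k v \<longrightarrow> slim \<Omega> \<delta> k v" by blast
    show ?A unfolding r_PES_le_iff
    proof (intro allI impI, rule ccontr)
      fix k v assume "PES \<Omega> k v" and "\<not> k \<le> m"
      then have k: "k \<ge> 1" "k \<ge> m + 1" by auto
      obtain u where "simplicial k u" using PES_simplicial[OF \<open>PES \<Omega> k v\<close>] by blast
      from not_slim_of_simplicial[OF refl k(1) this, of \<delta>] \<delta> k(2) show False by blast
    qed
  qed
  \<comment> \<open>The second equivalence is obtained by passing through the rank condition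
    \<open>?A\<close>.\<close>
  moreover have "?A \<longleftrightarrow> (\<forall>E. open_face \<Omega> E \<longrightarrow> r_PES E \<le> enat (m - 1))" (is "_ \<longleftrightarrow> ?C")
  proof
    assume *: ?A
    show ?C unfolding r_PES_le_iff
    proof (intro allI impI)
      fix E k v assume "open_face \<Omega> E" "PES E k v"
      then obtain v where "PES \<Omega> (Suc k) v" using PES_of_face assms(2) by blast
      then show "k \<le> m - 1" using * unfolding r_PES_le_iff by fastforce
    qed
  next
    assume *: ?C
    show ?A unfolding r_PES_le_iff
    proof (intro allI impI, rule ccontr)
      fix k v assume P: "PES \<Omega> k v" and "\<not> k \<le> m"
      \<comment> \<open>As \<open>m \<ge> 1\<close>, the facet dimension \<open>l\<close> is at
        least 1, and \<open>m - 1\<close> is a genuine subtraction, so \<open>l \<le> m - 1\<close>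
        is absurd.\<close>
      then obtain l where l: "k = Suc l" "l \<ge> m" by (cases k) auto
      then obtain E v where "open_face \<Omega> E" "PES E l v"
        using face_of_PES[of l v] P assms(3) by auto
      then have "l \<le> m - 1" using * unfolding r_PES_le_iff by blast
      then show False using l assms(3) by simp
    qed
  qed
  ultimately show ?thesis by blast
qed

end
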